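(* There exists an absolute constant $C>0$ such that the following holds. Let $k_1,k_2\ge1$ be integers, $m=k_1+k_2$, $0<p<1$, $a(p)=(1-p)^{k_1}p^{k_2}$, and let $n\ge m$ be an integer. Suppose $(n-m+1)a(p)\ge1$ and $m\,a(p)\le0.01$. Let $\mathrm H$ be the distribution of $N(n;k_1,k_2)=Y_m+Y_{m+1}+\dots+Y_n$ and put $$\tilde N=\frac{(n-m+1)^2}{(n-m+1)(2m-1)-m(m-1)},\quad N=\lfloor\tilde N\rfloor,\quad \bar p=\frac{(n-m+1)a(p)}{N},\quad A=\frac{a^3(p)}6(n-m+1)m(m-1).$$ Then $$\|\mathrm H-\mathrm{Bi}(N,\bar p)\|\le C\,\frac{a^{3/2}(p)m^2}{\sqrt{n-m+1}},$$ $$\|\mathrm H-\mathrm{Bi}(N,\bar p)(I+A(I_1-I)^3)\|\le C\,\frac{a(p)m^2(a(p)m+1)}{n-m+1}.$$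
   Context: $\eta_1,\eta_2,\dots$ are independent Bernoulli variables with $P(\eta_i=1)=1-P(\eta_i=0)=p$, and for $j=m,m+1,\dots,n$ $$Y_j=(1-\eta_{j-m+1})\cdots(1-\eta_{j-k_2})\,\eta_{j-k_2+1}\cdots\eta_{j-1}\eta_j .$$ $I_a$ is the unit mass at $a$, $I=I_0$; products and powers of measures are convolutions; $\mathrm{Bi}(N,\bar p)=(I+\bar p(I_1-I))^N$ is the binomial distribution; $\|M\|=\sum_{k\in\mathbb Z}|M\{k\}|$ is the total variation norm. $a^s(p)$ means $(a(p))^s$. *)

theory Defs
  imports "HOL-Probability.Probability" "HOL-Library.Poly_Mapping"
begin

definition run_Y :: "nat \<Rightarrow> nat \<Rightarrow> (nat \<Rightarrow> int) \<Rightarrow> nat \<Rightarrow> int" where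
  "run_Y k1 k2 \<eta> j =
     (\<Prod>i\<in>{j - (k1 + k2) + 1..j - k2}. 1 - \<eta> i) * (\<Prod>i\<in>{j - k2 + 1..j}. \<eta> i)"

definition run_N :: "nat \<Rightarrow> nat \<Rightarrow> nat \<Rightarrow> (nat \<Rightarrow> int) \<Rightarrow> int" where
  "run_N n k1 k2 \<eta> = (\<Sum>j\<in>{k1 + k2..n}. run_Y k1 k2 \<eta> j)"

text \<open>
  Only the variables with index in \<open>{1..n}\<close> enter \<^const>\<open>run_N\<close>, so its distribution is the image
  of the law of \<open>n\<close> independent Bernoulli variables. Taking their joint law directly keeps the
  distribution free of any underlying probability space (and of its type, on which an absolute
  constant must not depend); the lemma \<open>run_N_distribution\<close> below shows that every probability
  space carrying such variables gives this distribution.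
\<close>

definition bernoulli_law :: "real \<Rightarrow> int pmf" where
  "bernoulli_law p = map_pmf of_bool (bernoulli_pmf p)"

definition run_H :: "nat \<Rightarrow> nat \<Rightarrow> nat \<Rightarrow> real \<Rightarrow> int pmf" where
  "run_H n k1 k2 p = map_pmf (run_N n k1 k2) (Pi_pmf {1..n} 0 (\<lambda>_. bernoulli_law p))"

text \<open>
  Finitely supported signed measures on the integers are elements of the group algebra
  \<^typ>\<open>int \<Rightarrow>\<^sub>0 real\<close>, whose product is convolution. All measures in question other than \<^const>\<open>run_H\<close>
  are built from unit masses by finitely many ring operations and scalings.\<close>

abbreviation unit_mass :: "int \<Rightarrow> int \<Rightarrow>\<^sub>0 real" where
  "unit_mass a \<equiv> Poly_Mapping.single a 1"

abbreviation scaleM :: "real \<Rightarrow> (int \<Rightarrow>\<^sub>0 real) \<Rightarrow> (int \<Rightarrow>\<^sub>0 real)" where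
  "scaleM c M \<equiv> Poly_Mapping.map ((*) c) M"

definition Bi :: "nat \<Rightarrow> real \<Rightarrow> (int \<Rightarrow>\<^sub>0 real)" where
  "Bi N q = (unit_mass 0 + scaleM q (unit_mass 1 - unit_mass 0)) ^ N"

definition tv_norm :: "(int \<Rightarrow> real) \<Rightarrow> real" where
  "tv_norm M = (\<Sum>\<^sub>\<infinity>k. \<bar>M k\<bar>)"

lemma lookup_scaleM: "Poly_Mapping.lookup (scaleM c M) k = c * Poly_Mapping.lookup M k"
  by (simp add: Poly_Mapping.map.rep_eq when_def)

lemma run_N_cong:
  assumes "\<And>i. i \<in> {1..n} \<Longrightarrow> \<eta> i = \<eta>' i"
  shows "run_N n k1 k2 \<eta> = run_N n k1 k2 \<eta>'"
  unfolding run_N_def run_Y_def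
  by (intro sum.cong prod.cong arg_cong2[where f = "(*)"] refl) (auto simp: assms)

lemma pmf_bernoulli_law:
  assumes "0 \<le> p" "p \<le> 1"
  shows "pmf (bernoulli_law p) 1 = p" "pmf (bernoulli_law p) 0 = 1 - p"
    and "set_pmf (bernoulli_law p) \<subseteq> {0, 1}"
proof -
  have "pmf (map_pmf of_bool (bernoulli_pmf p)) (of_bool b :: int) = pmf (bernoulli_pmf p) b" for b
    by (rule pmf_map_inj') (auto simp: inj_on_def)
  from this[of True] this[of False] assms
  show "pmf (bernoulli_law p) 1 = p" "pmf (bernoulli_law p) 0 = 1 - p"
    by (simp_all add: bernoulli_law_def)
  show "set_pmf (bernoulli_law p) \<subseteq> {0, 1}"
    by (auto simp: bernoulli_law_def)
qed

lemma (in prob_space) run_N_distribution: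
  fixes \<eta> :: "nat \<Rightarrow> 'a \<Rightarrow> int"
  assumes indep: "indep_vars (\<lambda>_. count_space UNIV) \<eta> {1..}"
    and one: "\<And>i. i \<ge> 1 \<Longrightarrow> prob {\<omega> \<in> space M. \<eta> i \<omega> = 1} = p"
    and zero: "\<And>i. i \<ge> 1 \<Longrightarrow> prob {\<omega> \<in> space M. \<eta> i \<omega> = 0} = 1 - p"
  shows "prob {\<omega> \<in> space M. run_N n k1 k2 (\<lambda>i. \<eta> i \<omega>) = k} = pmf (run_H n k1 k2 p) k"
proof -
  have p: "0 \<le> p" "p \<le> 1"
    using one[of 1] by (auto simp: prob_le_1 intro: order_trans[OF measure_nonneg])
  have rv [measurable]: "\<eta> i \<in> measurable M (count_space UNIV)" if "i \<ge> 1" for i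
    using indep that by (auto simp: indep_vars_def)
  have ev: "{\<omega> \<in> space M. \<eta> i \<omega> = b} \<in> sets M" if "i \<ge> 1" for i b
    using measurable_sets[OF rv[OF that], of "{b}"]
    by (simp add: vimage_def Int_def conj_commute)
  define P where "P = Pi_pmf {1..n} 0 (\<lambda>_. bernoulli_law p)"
  define h where "h = (\<lambda>\<omega> i. if i \<in> {1..n} then \<eta> i \<omega> else 0)"
  define F where "F = PiE_dflt {1..n} 0 (\<lambda>_. {0, 1 :: int})"
  define S where "S = run_N n k1 k2"
  have finF: "finite F"
    unfolding F_def by (intro finite_PiE_dflt) auto
  have supp: "set_pmf P \<subseteq> F"
    using pmf_bernoulli_law(3)[OF p]
    unfolding P_def F_def by (auto simp: set_Pi_pmf PiE_dflt_def)
  have hev: "{\<omega> \<in> space M. h \<omega> = f} \<in> sets M \<and> prob {\<omega> \<in> space M. h \<omega> = f} = pmf P f"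
    if f: "f \<in> F" for f
  proof (cases "n = 0")
    case True
    have "h \<omega> = f" for \<omega>
      using f True by (auto simp: h_def F_def PiE_dflt_def fun_eq_iff)
    moreover have "pmf P f = 1"
      using f True by (auto simp: P_def F_def PiE_dflt_def pmf_return fun_eq_iff indicator_def)
    ultimately show ?thesis by (simp add: prob_space)
  next
    case False
    have eq: "{\<omega> \<in> space M. h \<omega> = f} = (\<Inter>i\<in>{1..n}. \<eta> i -` {f i} \<inter> space M)"
      using f False by (auto simp: h_def F_def PiE_dflt_def fun_eq_iff)
    have "prob (\<Inter>i\<in>{1..n}. \<eta> i -` {f i} \<inter> space M) = (\<Prod>i\<in>{1..n}. prob (\<eta> i -` {f i} \<inter> space M))"
      using False by (intro indep_varsD[OF indep]) auto
    also have "\<dots> = (\<Prod>i\<in>{1..n}. pmf (bernoulli_law p) (f i))"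
    proof (rule prod.cong)
      fix i assume i: "i \<in> {1..n}"
      have "f i = 0 \<or> f i = 1" using f i by (auto simp: F_def PiE_dflt_def)
      moreover have "\<eta> i -` {f i} \<inter> space M = {\<omega> \<in> space M. \<eta> i \<omega> = f i}" by auto
      ultimately show "prob (\<eta> i -` {f i} \<inter> space M) = pmf (bernoulli_law p) (f i)"
        using i one[of i] zero[of i] pmf_bernoulli_law[OF p] by auto
    qed simp
    also have "\<dots> = pmf P f"
      unfolding P_def using f by (intro pmf_Pi'[symmetric]) (auto simp: F_def PiE_dflt_def)
    finally have "prob {\<omega> \<in> space M. h \<omega> = f} = pmf P f" using eq by simp
    moreover have "(\<Inter>i\<in>{1..n}. \<eta> i -` {f i} \<inter> space M) \<in> sets M"
      using False by (intro sets.finite_INT measurable_sets[OF rv]) auto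
    ultimately show ?thesis using eq by simp
  qed
  have "AE \<omega> in M. \<eta> i \<omega> \<in> {0, 1}" if i: "i \<ge> 1" for i
  proof -
    have "prob ({\<omega> \<in> space M. \<eta> i \<omega> = 0} \<union> {\<omega> \<in> space M. \<eta> i \<omega> = 1}) = 1"
      using one[OF i] zero[OF i] ev[OF i] by (subst finite_measure_Union) auto
    then have "AE \<omega> in M. \<omega> \<in> {\<omega> \<in> space M. \<eta> i \<omega> = 0} \<union> {\<omega> \<in> space M. \<eta> i \<omega> = 1}"
      using ev[OF i] by (subst (asm) prob_eq_1) auto
    then show ?thesis by eventually_elim auto
  qed
  then have "AE \<omega> in M. \<forall>i\<in>{1..n}. \<eta> i \<omega> \<in> {0, 1}"
    by (intro AE_ball_countable[THEN iffD2]) auto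
  then have AE: "AE \<omega> in M. h \<omega> \<in> F"
    by eventually_elim (auto simp: h_def F_def PiE_dflt_def)
  have S_h: "run_N n k1 k2 (\<lambda>i. \<eta> i \<omega>) = S (h \<omega>)" for \<omega>
    unfolding S_def by (rule run_N_cong) (auto simp: h_def)
  have hS: "(\<lambda>\<omega>. S (h \<omega>)) \<in> measurable M (count_space UNIV)"
  proof -
    have hi: "(\<lambda>\<omega>. h \<omega> i) \<in> measurable M (count_space UNIV)" for i
    proof (cases "i \<in> {1..n}")
      case True
      then have "(\<lambda>\<omega>. h \<omega> i) = \<eta> i" unfolding h_def by (simp only: if_True)
      then show ?thesis using rv[of i] True by simp
    next
      case False
      then have "(\<lambda>\<omega>. h \<omega> i) = (\<lambda>_. 0)" unfolding h_def by (simp only: if_False)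
      then show ?thesis by simp
    qed
    have hb: "(\<lambda>\<omega>. real_of_int (h \<omega> i)) \<in> borel_measurable M" for i
      by (rule measurable_compose[OF hi]) simp
    have "(\<lambda>\<omega>. real_of_int (S (h \<omega>))) \<in> borel_measurable M"
      unfolding S_def run_N_def run_Y_def of_int_sum of_int_mult of_int_prod of_int_diff of_int_1
      by (intro borel_measurable_sum borel_measurable_times borel_measurable_prod
          borel_measurable_diff borel_measurable_const hb)
    then have "(\<lambda>\<omega>. \<lfloor>real_of_int (S (h \<omega>))\<rfloor>) \<in> measurable M (count_space UNIV)"
      by (rule measurable_compose) simp
    then show ?thesis by simp
  qed
  let ?G = "{f \<in> F. S f = k}"
  have evk: "{\<omega> \<in> space M. S (h \<omega>) = k} \<in> sets M"
    using measurable_sets[OF hS, of "{k}"] by (simp add: vimage_def Int_def conj_commute)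
  have evG: "(\<Union>f\<in>?G. {\<omega> \<in> space M. h \<omega> = f}) \<in> sets M"
    using finF hev by (intro sets.finite_UN) auto
  have "prob {\<omega> \<in> space M. S (h \<omega>) = k} = prob (\<Union>f\<in>?G. {\<omega> \<in> space M. h \<omega> = f})"
    by (rule finite_measure_eq_AE[OF _ evk evG]) (use AE in eventually_elim, auto)
  also have "\<dots> = (\<Sum>f\<in>?G. prob {\<omega> \<in> space M. h \<omega> = f})"
    using finF hev by (intro finite_measure_finite_Union) (auto simp: disjoint_family_on_def)
  also have "\<dots> = (\<Sum>f\<in>?G. pmf P f)"
    using hev by (intro sum.cong) auto
  also have "\<dots> = measure_pmf.prob P ?G"
    using finF by (subst measure_measure_pmf_finite) auto
  also have "\<dots> = measure_pmf.prob P (S -` {k})"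
    using supp by (intro measure_pmf.finite_measure_eq_AE) (auto simp: AE_measure_pmf_iff)
  also have "\<dots> = pmf (run_H n k1 k2 p) k"
    by (simp add: run_H_def pmf_map P_def S_def)
  finally show ?thesis by (simp add: S_h)
qed

end

theory Submission
  imports Defs
begin

text \<open>
  The word of $k_1$ failures followed by $k_2$ successes has no proper border, so occurrences are
  disjoint and the generating function of their number satisfies
  $F_n = F_{n-1} + a w F_{n-m}$ with $w = I_1 - I$. In the Banach algebra of absolutely summable
  sequences under convolution the quotients $F_j / F_{j-1}$ are close to the unit when $m a$ is
  small, hence $F_n = \exp G$ with $G$ a power series in $a w$; its first three coefficients are
  read off $F_n = \sum_r {n - (m-1) r \choose r} (a w)^r$ and the rest is bounded by $O(L m^3 a^4)$,
  $L = n - m + 1$. The binomial law is an exponential of the same kind. The parameters make the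
  first two coefficients agree up to the rounding of $N$, and the third ones differ by
  $A$ up to $O(a^3 m^3)$. The Poisson factor $e^{L a w}$ contained in both exponentials
  smooths: $\|w^j e^{t w}\| \le (j/t)^{j/2}$, which follows from the case $j = 1$, where
  $\|w e^{t w}\|$ is the first absolute central moment of the Poisson law divided by $t$.
\<close>

section \<open>The Banach algebra of absolutely summable power series\<close>

text \<open>Put t = L a and e = m a. The two exponents differ by A w^3 + w^2 \<eta> + w^4 \<theta>
  with \<eta> = O(e^2) and \<theta> = O(t e^3). These quantities need not be small: A is of order t
  e^2 and unbounded in t, so expanding the exponential by norms alone fails. What rescues the
  estimate is that each error keeps its power of w as an exact factor, and every w gains t^(-1/2)
  once a share of the Poisson factor is spent on it. The orders become e^2 / sqrt t for A w^3, and
  e^2 / t and e^3 / t for the other two, which are the two right-hand sides of the theorem. This is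
  why remainders are stated as products such as x^4 * t and never as bare bounds. The condition e
  \<le> 1/100 serves mainly to keep the w^2 part of each exponent below a fixed fraction of t.
  Absolutely summable series play two roles. They are the measures on the nonnegative integers, with
  total variation as norm, and they are a functional calculus applied to elements of norm at most 1.
  In the second role a bound on the norm of G acts as a Cauchy estimate for its tail.\<close>

typedef l1 = "{f :: real fps. summable (\<lambda>n. \<bar>fps_nth f n\<bar>)}"
  morphisms fps_of_l1 Abs_l1
  by (rule exI[of _ 0]) simp

setup_lifting type_definition_l1

lift_definition coeff1 :: "l1 \<Rightarrow> nat \<Rightarrow> real" is fps_nth .

lemma summable_coeff1: "summable (\<lambda>n. \<bar>coeff1 f n\<bar>)"
  by transfer simp

lemma l1_eqI: "(\<And>n. coeff1 f n = coeff1 g n) \<Longrightarrow> f = g"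
  by transfer (simp add: fps_eq_iff)

lemma coeff1_Abs: "summable (\<lambda>n. \<bar>f n\<bar>) \<Longrightarrow> coeff1 (Abs_l1 (Abs_fps f)) n = f n"
  by (simp add: coeff1.rep_eq Abs_l1_inverse)

lemma abs_fps_mult_nth_le:
  fixes f g :: "real fps"
  shows "\<bar>fps_nth (f * g) n\<bar> \<le> (\<Sum>i\<le>n. \<bar>fps_nth f i\<bar> * \<bar>fps_nth g (n - i)\<bar>)"
  unfolding fps_mult_nth atLeast0AtMost
  by (rule order_trans[OF sum_abs]) (simp add: abs_mult)

lemma summable_fps_mult:
  fixes f g :: "real fps"
  assumes "summable (\<lambda>n. \<bar>fps_nth f n\<bar>)" "summable (\<lambda>n. \<bar>fps_nth g n\<bar>)"
  shows "summable (\<lambda>n. \<bar>fps_nth (f * g) n\<bar>)"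
  by (rule summable_comparison_test'[OF summable_Cauchy_product, of "\<lambda>n. \<bar>fps_nth f n\<bar>" "\<lambda>n. \<bar>fps_nth g n\<bar>" 0])
    (use assms abs_fps_mult_nth_le in auto)

lemma summable_fps_plus:
  fixes f g :: "real fps"
  assumes "summable (\<lambda>n. \<bar>fps_nth f n\<bar>)" "summable (\<lambda>n. \<bar>fps_nth g n\<bar>)"
  shows "summable (\<lambda>n. \<bar>fps_nth (f + g) n\<bar>)"
  by (rule summable_comparison_test'[OF summable_add[OF assms], where N = 0]) auto

lemma summable_fps_minus:
  fixes f g :: "real fps"
  assumes "summable (\<lambda>n. \<bar>fps_nth f n\<bar>)" "summable (\<lambda>n. \<bar>fps_nth g n\<bar>)"
  shows "summable (\<lambda>n. \<bar>fps_nth (f - g) n\<bar>)"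
  by (rule summable_comparison_test'[OF summable_add[OF assms], where N = 0]) auto

instantiation l1 :: comm_ring_1
begin
lift_definition zero_l1 :: l1 is 0 by simp
lift_definition one_l1 :: l1 is 1
  by (rule summable_finite[of "{0}"]) auto
lift_definition plus_l1 :: "l1 \<Rightarrow> l1 \<Rightarrow> l1" is "(+)"
  by (rule summable_fps_plus)
lift_definition uminus_l1 :: "l1 \<Rightarrow> l1" is uminus by simp
lift_definition minus_l1 :: "l1 \<Rightarrow> l1 \<Rightarrow> l1" is "(-)"
  by (rule summable_fps_minus)
lift_definition times_l1 :: "l1 \<Rightarrow> l1 \<Rightarrow> l1" is "(*)"
  by (rule summable_fps_mult)
instance
  by standard (transfer, simp add: algebra_simps)+
end

instantiation l1 :: real_normed_vector
begin
lift_definition scaleR_l1 :: "real \<Rightarrow> l1 \<Rightarrow> l1" is "\<lambda>c f. fps_const c * f"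
  by (simp add: abs_mult summable_mult)
lift_definition norm_l1 :: "l1 \<Rightarrow> real" is "\<lambda>f. suminf (\<lambda>n. \<bar>fps_nth f n\<bar>)" .
definition dist_l1 :: "l1 \<Rightarrow> l1 \<Rightarrow> real" where "dist_l1 f g = norm (f - g)"
definition sgn_l1 :: "l1 \<Rightarrow> l1" where "sgn_l1 f = inverse (norm f) *\<^sub>R f"
definition uniformity_l1 :: "(l1 \<times> l1) filter" where
  "uniformity_l1 = (INF e\<in>{0<..}. principal {(x, y). dist x y < e})"
definition open_l1 :: "l1 set \<Rightarrow> bool" where
  "open_l1 U = (\<forall>x\<in>U. eventually (\<lambda>(x', y). x' = x \<longrightarrow> y \<in> U) uniformity)"
instance
proof
  fix f g :: l1 and a b :: real
  show "dist f g = norm (f - g)" by (rule dist_l1_def)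
  show "sgn f = inverse (norm f) *\<^sub>R f" by (rule sgn_l1_def)
  show "uniformity = (INF e\<in>{0<..}. principal {(x, y :: l1). dist x y < e})"
    by (rule uniformity_l1_def)
  show "open U = (\<forall>x\<in>U. eventually (\<lambda>(x', y). x' = x \<longrightarrow> y \<in> U) uniformity)" for U :: "l1 set"
    by (rule open_l1_def)
  show "a *\<^sub>R (f + g) = a *\<^sub>R f + a *\<^sub>R g" "(a + b) *\<^sub>R f = a *\<^sub>R f + b *\<^sub>R f"
    "a *\<^sub>R b *\<^sub>R f = (a * b) *\<^sub>R f" "1 *\<^sub>R f = f"
    by (transfer, simp add: fps_eq_iff algebra_simps)+
  show "norm f = 0 \<longleftrightarrow> f = 0"
    by transfer (simp add: suminf_eq_zero_iff fps_eq_iff)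
  show "norm (f + g) \<le> norm f + norm g"
  proof (transfer, simp)
    fix f g :: "real fps"
    assume s: "summable (\<lambda>n. \<bar>fps_nth f n\<bar>)" "summable (\<lambda>n. \<bar>fps_nth g n\<bar>)"
    show "suminf (\<lambda>n. \<bar>fps_nth f n + fps_nth g n\<bar>) \<le> suminf (\<lambda>n. \<bar>fps_nth f n\<bar>) + suminf (\<lambda>n. \<bar>fps_nth g n\<bar>)"
      unfolding suminf_add[OF s]
      by (intro suminf_le summable_add s summable_comparison_test'[OF summable_add[OF s], where N = 0]) auto
  qed
  show "norm (a *\<^sub>R f) = \<bar>a\<bar> * norm f"
    by transfer (simp add: abs_mult suminf_mult)
qed
end

lemma norm_l1_altdef: "norm f = suminf (\<lambda>n. \<bar>coeff1 f n\<bar>)"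
  by transfer simp

lemma coeff1_simps [simp]:
  "coeff1 0 n = 0" "coeff1 (f + g) n = coeff1 f n + coeff1 g n"
  "coeff1 (f - g) n = coeff1 f n - coeff1 g n" "coeff1 (- f) n = - coeff1 f n"
  "coeff1 (c *\<^sub>R f) n = c * coeff1 f n" "coeff1 1 n = (if n = 0 then 1 else 0)"
  by (transfer, simp)+

lemma coeff1_mult: "coeff1 (f * g) n = (\<Sum>i\<le>n. coeff1 f i * coeff1 g (n - i))"
  by transfer (simp add: fps_mult_nth atLeast0AtMost)

instance l1 :: real_normed_algebra_1
proof
  fix f g :: l1 and a :: real
  show "a *\<^sub>R f * g = a *\<^sub>R (f * g)" "f * a *\<^sub>R g = a *\<^sub>R (f * g)"
    by (transfer, simp add: mult_ac)+
  show "norm (1 :: l1) = 1"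
    unfolding norm_l1_altdef by (subst suminf_finite[of "{0}"]) auto
  show "norm (f * g) \<le> norm f * norm g"
  proof transfer
    fix f g :: "real fps"
    assume s: "summable (\<lambda>n. \<bar>fps_nth f n\<bar>)" "summable (\<lambda>n. \<bar>fps_nth g n\<bar>)"
    show "suminf (\<lambda>n. \<bar>fps_nth (f * g) n\<bar>) \<le> suminf (\<lambda>n. \<bar>fps_nth f n\<bar>) * suminf (\<lambda>n. \<bar>fps_nth g n\<bar>)"
      using s by (subst Cauchy_product)
        (auto intro!: suminf_le abs_fps_mult_nth_le summable_fps_mult summable_Cauchy_product)
  qed
qed

lemma abs_coeff1_le: "\<bar>coeff1 f n\<bar> \<le> norm f"
  unfolding norm_l1_altdef
  using sum_le_suminf[OF summable_coeff1, of "{n}" f] by simp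

lemma bounded_linear_coeff1: "bounded_linear (\<lambda>f. coeff1 f n)"
  by (rule bounded_linear_intro[of _ 1]) (auto simp: abs_coeff1_le)

lemma norm_l1_le:
  assumes "\<And>N. (\<Sum>n<N. \<bar>coeff1 f n\<bar>) \<le> B"
  shows "norm f \<le> B"
  unfolding norm_l1_altdef by (rule suminf_le_const[OF summable_coeff1 assms])

lemma sum_abs_coeff1_le: "(\<Sum>n<N. \<bar>coeff1 f n\<bar>) \<le> norm f"
  unfolding norm_l1_altdef by (rule sum_le_suminf[OF summable_coeff1]) auto

text \<open>Coordinates of a Cauchy sequence converge because each \<open>coeff1\<close> is
  continuous. The Cauchy bound passes to the limit on every finite block of coordinates
  (\<open>close\<close>), and \<open>norm_l1_le\<close> lifts it to the norm, so no limit is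
  exchanged with an infinite sum.\<close>

instance l1 :: banach
proof
  fix X :: "nat \<Rightarrow> l1"
  assume X: "Cauchy X"
  have "convergent (\<lambda>i. coeff1 (X i) n)" for n
    using bounded_linear.Cauchy[OF bounded_linear_coeff1 X] by (rule Cauchy_convergent)
  then have lim: "(\<lambda>i. coeff1 (X i) n) \<longlonglongrightarrow> lim (\<lambda>i. coeff1 (X i) n)" for n
    by (simp add: convergent_LIMSEQ_iff)
  define h where "h n = lim (\<lambda>i. coeff1 (X i) n)" for n
  have close: "(\<Sum>n<N. \<bar>coeff1 (X i) n - h n\<bar>) \<le> e" if "\<And>j. j \<ge> M \<Longrightarrow> norm (X i - X j) \<le> e" for i N M e
  proof (rule tendsto_upperbound)
    show "(\<lambda>j. \<Sum>n<N. \<bar>coeff1 (X i) n - coeff1 (X j) n\<bar>) \<longlonglongrightarrow> (\<Sum>n<N. \<bar>coeff1 (X i) n - h n\<bar>)"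
      unfolding h_def by (intro tendsto_intros lim)
    show "\<forall>\<^sub>F j in sequentially. (\<Sum>n<N. \<bar>coeff1 (X i) n - coeff1 (X j) n\<bar>) \<le> e"
      using eventually_ge_at_top[of M]
    proof eventually_elim
      case (elim j)
      then show ?case using sum_abs_coeff1_le[of "X i - X j" N] that[of j] by simp
    qed
  qed simp
  obtain M where M: "norm (X M - X j) < 1" if "j \<ge> M" for j
    using X[unfolded Cauchy_iff, rule_format, of 1] by auto
  have sumh: "summable (\<lambda>n. \<bar>h n\<bar>)"
  proof (rule summableI_nonneg_bounded)
    fix N
    have "(\<Sum>n<N. \<bar>h n\<bar>) \<le> (\<Sum>n<N. \<bar>coeff1 (X M) n\<bar> + \<bar>coeff1 (X M) n - h n\<bar>)"
      by (rule sum_mono) auto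
    also have "\<dots> \<le> norm (X M) + 1"
      unfolding sum.distrib using M
      by (intro add_mono sum_abs_coeff1_le close[of M]) (auto intro: less_imp_le)
    finally show "(\<Sum>n<N. \<bar>h n\<bar>) \<le> norm (X M) + 1" .
  qed simp
  define Y where "Y = Abs_l1 (Abs_fps h)"
  have Y: "coeff1 Y n = h n" for n
    unfolding Y_def by (rule coeff1_Abs[OF sumh])
  have "X \<longlonglongrightarrow> Y"
  proof (rule LIMSEQ_I)
    fix e :: real assume "e > 0"
    then obtain K where K: "norm (X i - X j) < e / 2" if "i \<ge> K" "j \<ge> K" for i j
      using X[unfolded Cauchy_iff, rule_format, of "e / 2"] by auto
    have "norm (X i - Y) < e" if "i \<ge> K" for i
    proof -
      have "norm (X i - Y) \<le> e / 2"
        by (rule norm_l1_le, unfold coeff1_simps Y, rule close[of K]) (use K that less_imp_le in blast)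
      then show ?thesis using \<open>e > 0\<close> by simp
    qed
    then show "\<exists>K. \<forall>i\<ge>K. norm (X i - Y) < e" by blast
  qed
  then show "convergent X" by (rule convergentI)
qed

section \<open>Evaluation homomorphisms and logarithms\<close>

lift_definition lX :: l1 is fps_X
  by (rule summable_finite[of "{1}"]) (auto simp: fps_X_def)

lemma coeff1_lX: "coeff1 lX n = (if n = 1 then 1 else 0)"
  by transfer (simp add: fps_X_def)

text \<open>Division by the variable once the constant term is dropped. It does not increase the
  norm, so iterating it gives Taylor remainders controlled by the norm of the whole series.\<close>

lift_definition lshift :: "l1 \<Rightarrow> l1" is "fps_shift 1"
  by (simp add: summable_Suc_iff[of "\<lambda>n. \<bar>fps_nth _ n\<bar>"])

lemma coeff1_lshift: "coeff1 (lshift f) n = coeff1 f (Suc n)"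
  by transfer simp

lemma coeff1_lX_mult: "coeff1 (lX * f) n = (if n = 0 then 0 else coeff1 f (n - 1))"
  by transfer simp

lemma coeff1_lX_power: "coeff1 (lX ^ r) n = (if n = r then 1 else 0)"
  by (induction r arbitrary: n) (auto simp: coeff1_lX_mult)

lemma l1_split: "f = coeff1 f 0 *\<^sub>R 1 + lX * lshift f"
  by (rule l1_eqI) (auto simp: coeff1_lX_mult coeff1_lshift)

lemma norm_lX: "norm lX = 1"
  unfolding norm_l1_altdef by (subst suminf_finite[of "{1}"]; simp add: coeff1_lX)

lemma norm_lshift_le: "norm (lshift f) \<le> norm f"
proof (rule norm_l1_le)
  fix N
  have "(\<Sum>n<N. \<bar>coeff1 (lshift f) n\<bar>) \<le> (\<Sum>n<Suc N. \<bar>coeff1 f n\<bar>)"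
    by (simp only: sum.lessThan_Suc_shift coeff1_lshift)
  also have "\<dots> \<le> norm f" by (rule sum_abs_coeff1_le)
  finally show "(\<Sum>n<N. \<bar>coeff1 (lshift f) n\<bar>) \<le> norm f" .
qed

text \<open>For \<open>norm x \<le> 1\<close> this is a contractive algebra homomorphism that
  commutes with \<open>exp\<close>. The target stays general: values in the reals identify a series,
  values in \<open>l1\<close> are measures.\<close>

definition leval :: "'a::{real_normed_algebra_1,banach} \<Rightarrow> l1 \<Rightarrow> 'a" where
  "leval x f = suminf (\<lambda>n. coeff1 f n *\<^sub>R x ^ n)"

context
  fixes x :: "'a::{real_normed_algebra_1,banach}"
  assumes x: "norm x \<le> 1"
begin

lemma norm_leval_term: "norm (coeff1 f n *\<^sub>R x ^ n) \<le> \<bar>coeff1 f n\<bar>"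
proof -
  have "norm (x ^ n) \<le> 1"
    using norm_power_ineq[of x n] power_le_one[OF norm_ge_zero x, of n] by linarith
  then show ?thesis by (simp add: mult_left_le)
qed

lemma summable_norm_leval: "summable (\<lambda>n. norm (coeff1 f n *\<^sub>R x ^ n))"
  by (rule summable_comparison_test'[OF summable_coeff1, of 0]) (use norm_leval_term in simp)

lemma leval_sums: "(\<lambda>n. coeff1 f n *\<^sub>R x ^ n) sums leval x f"
  unfolding leval_def by (rule summable_sums[OF summable_norm_cancel[OF summable_norm_leval]])

lemma norm_leval_le: "norm (leval x f) \<le> norm f"
proof -
  have "norm (leval x f) \<le> suminf (\<lambda>n. norm (coeff1 f n *\<^sub>R x ^ n))"
    unfolding leval_def by (rule summable_norm[OF summable_norm_leval])
  also have "\<dots> \<le> norm f"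
    unfolding norm_l1_altdef by (rule suminf_le[OF norm_leval_term summable_norm_leval summable_coeff1])
  finally show ?thesis .
qed

lemma leval_add: "leval x (f + g) = leval x f + leval x g"
  by (rule sums_unique2[OF leval_sums])
    (use sums_add[OF leval_sums leval_sums, of f g] in \<open>simp add: scaleR_add_left\<close>)

lemma leval_scaleR: "leval x (c *\<^sub>R f) = c *\<^sub>R leval x f"
  by (rule sums_unique2[OF leval_sums])
    (use sums_scaleR_right[OF leval_sums, of c f] in simp)

lemma bounded_linear_leval: "bounded_linear (leval x)"
  by (rule bounded_linear_intro[of _ 1]) (auto simp: leval_add leval_scaleR norm_leval_le)

lemma leval_mult: "leval x (f * g) = leval x f * leval x g"
proof -
  have "leval x f * leval x g =
      suminf (\<lambda>k. \<Sum>i\<le>k. (coeff1 f i *\<^sub>R x ^ i) * (coeff1 g (k - i) *\<^sub>R x ^ (k - i)))"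
    unfolding leval_def by (rule Cauchy_product) (rule summable_norm_leval)+
  also have "\<dots> = leval x (f * g)"
    unfolding leval_def
  proof (rule arg_cong[where f = suminf], rule ext)
    fix k
    have "(\<Sum>i\<le>k. (coeff1 f i *\<^sub>R x ^ i) * (coeff1 g (k - i) *\<^sub>R x ^ (k - i))) =
      (\<Sum>i\<le>k. (coeff1 f i * coeff1 g (k - i)) *\<^sub>R x ^ k)"
      by (rule sum.cong) (auto simp: power_add[symmetric])
    then show "(\<Sum>i\<le>k. (coeff1 f i *\<^sub>R x ^ i) * (coeff1 g (k - i) *\<^sub>R x ^ (k - i))) =
      coeff1 (f * g) k *\<^sub>R x ^ k"
      by (simp add: coeff1_mult scaleR_left.sum)
  qed
  finally show ?thesis by simp
qed

lemma leval_1: "leval x 1 = 1"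
  unfolding leval_def by (subst suminf_finite[of "{0}"]) auto

lemma leval_lX: "leval x lX = x"
  unfolding leval_def by (subst suminf_finite[of "{1}"]) (auto simp: coeff1_lX)

lemma leval_power: "leval x (f ^ n) = leval x f ^ n"
  by (induction n) (auto simp: leval_1 leval_mult)

lemma leval_exp: "leval x (exp f) = exp (leval x f)"
proof -
  have "(\<lambda>n. leval x (f ^ n /\<^sub>R fact n)) sums leval x (exp f)"
    by (rule bounded_linear.sums[OF bounded_linear_leval exp_converges])
  moreover have "(\<lambda>n. leval x (f ^ n /\<^sub>R fact n)) = (\<lambda>n. leval x f ^ n /\<^sub>R fact n)"
    by (simp add: leval_scaleR leval_power)
  ultimately show ?thesis
    using exp_converges[of "leval x f"] sums_unique2 by metis
qed

lemma leval_split4: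
  "leval x f = coeff1 f 0 *\<^sub>R 1 + coeff1 f 1 *\<^sub>R x + coeff1 f 2 *\<^sub>R x ^ 2 + coeff1 f 3 *\<^sub>R x ^ 3
     + x ^ 4 * leval x ((lshift ^^ 4) f)"
proof -
  have step: "leval x g = coeff1 g 0 *\<^sub>R 1 + x * leval x (lshift g)" for g
    using arg_cong[where f = "leval x", OF l1_split[of g]]
    by (simp only: leval_add leval_scaleR leval_1 leval_mult leval_lX)
  have "leval x f = coeff1 f 0 *\<^sub>R 1 + x * (coeff1 f 1 *\<^sub>R 1 + x * (coeff1 f 2 *\<^sub>R 1 +
      x * (coeff1 f 3 *\<^sub>R 1 + x * leval x ((lshift ^^ 4) f))))"
    using step[of f] step[of "lshift f"] step[of "lshift (lshift f)"] step[of "lshift (lshift (lshift f))"]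
    by (simp add: coeff1_lshift numeral_eq_Suc)
  also have "\<dots> = coeff1 f 0 *\<^sub>R 1 + coeff1 f 1 *\<^sub>R x + coeff1 f 2 *\<^sub>R x ^ 2 + coeff1 f 3 *\<^sub>R x ^ 3
     + x ^ 4 * leval x ((lshift ^^ 4) f)"
    by (simp only: power2_eq_square power3_eq_cube power4_eq_xxxx distrib_left mult_scaleR_right mult_1_right mult.assoc add.assoc)
  finally show ?thesis .
qed

end

text \<open>Identity theorem. Vanishing on the open interval is inherited by
  \<open>lshift h\<close>: away from 0 one divides by z, and at 0 the constant term is at most z * K
  for every small positive z. Hence all coefficients of the difference vanish in turn.\<close>

lemma l1_eqI_leval:
  assumes eq: "\<And>z :: real. \<bar>z\<bar> < 1 \<Longrightarrow> leval z f = leval z g"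
  shows "f = g"
proof -
  have step: "leval z h = coeff1 h 0 + z * leval z (lshift h)" if "\<bar>z\<bar> < 1" for z :: real and h
  proof -
    have z: "norm z \<le> 1" using that by simp
    show ?thesis
      using arg_cong[where f = "leval z", OF l1_split[of h]]
      by (simp add: leval_add[OF z] leval_scaleR[OF z] leval_1[OF z] leval_mult[OF z] leval_lX[OF z])
  qed
  define Z where "Z h = (\<forall>z :: real. \<bar>z\<bar> < 1 \<longrightarrow> leval z h = 0)" for h
  have Z0: "coeff1 h 0 = 0" if "Z h" for h
    using that step[of 0 h] by (simp add: Z_def)
  have ZS: "Z (lshift h)" if h: "Z h" for h
  proof -
    have nz: "leval z (lshift h) = 0" if "\<bar>z\<bar> < 1" "z \<noteq> 0" for z :: real
      using step[of z h] that h Z0[OF h] by (simp add: Z_def)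
    have "\<bar>coeff1 (lshift h) 0\<bar> \<le> e" if e: "e > 0" for e
    proof -
      define K where "K = norm (lshift (lshift h)) + 1"
      have K: "K > 0" by (simp add: K_def add_nonneg_pos)
      define z where "z = min (1 / 2) (e / K)"
      have z: "0 < z" "\<bar>z\<bar> < 1" "z * K \<le> e"
        using K e by (auto simp: z_def min_def field_simps)
      have "\<bar>coeff1 (lshift h) 0\<bar> = \<bar>z * leval z (lshift (lshift h))\<bar>"
        using step[of z "lshift h"] nz[of z] z by (simp add: eq_neg_iff_add_eq_0)
      also have "\<dots> \<le> z * K"
        using norm_leval_le[of z "lshift (lshift h)"] z by (simp add: abs_mult K_def mult_left_mono)
      finally show ?thesis using z by linarith
    qed
    then have "coeff1 (lshift h) 0 = 0"
      using field_le_epsilon[of "\<bar>coeff1 (lshift h) 0\<bar>" 0] by simp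
    then have "leval 0 (lshift h) = (0 :: real)" using step[of 0 "lshift h"] by simp
    then show ?thesis using nz by (auto simp: Z_def)
  qed
  have "coeff1 h n = 0" if "Z h" for h n
    using that
  proof (induction n arbitrary: h)
    case (Suc n)
    then show ?case using ZS[of h] by (simp flip: coeff1_lshift)
  qed (rule Z0)
  moreover have "Z (f - g)"
    unfolding Z_def
  proof (intro allI impI)
    fix z :: real assume "\<bar>z\<bar> < 1"
    then show "leval z (f - g) = 0" using leval_add[of z "f - g" g] eq[of z] by simp
  qed
  ultimately have "coeff1 (f - g) n = 0" for n by blast
  then show ?thesis by (intro l1_eqI) simp
qed

text \<open>The power series of $\ln (1 + X/2)$; the factor $1/2$ keeps its coefficients absolutely summable.\<close>

definition lln_coeff :: "nat \<Rightarrow> real" where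
  "lln_coeff n = (if n = 0 then 0 else - ((- 1 / 2) ^ n / real n))"

definition lln :: l1 where "lln = Abs_l1 (Abs_fps lln_coeff)"

text \<open>Dropping the denominators leaves 1/2 + 1/4 + ..., whose partial sums are
  explicit.\<close>

lemma sum_abs_lln_coeff: "(\<Sum>n<Suc N. \<bar>lln_coeff n\<bar>) \<le> 1 - (1 / 2) ^ N"
proof (induction N)
  case (Suc N)
  have "\<bar>lln_coeff (Suc N)\<bar> \<le> (1 / 2) ^ Suc N"
  proof -
    have "\<bar>lln_coeff (Suc N)\<bar> = (1 / 2) ^ Suc N / real (Suc N)"
      unfolding lln_coeff_def by (simp add: power_abs abs_mult)
    also have "\<dots> \<le> (1 / 2) ^ Suc N / 1"
      by (rule divide_left_mono) auto
    finally show ?thesis by simp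
  qed
  with Suc show ?case by simp
qed (simp add: lln_coeff_def)

lemma sum_abs_lln_coeff_le: "(\<Sum>n<N. \<bar>lln_coeff n\<bar>) \<le> 1"
proof (cases N)
  case (Suc M)
  then show ?thesis using order_trans[OF sum_abs_lln_coeff[of M], of 1] by simp
qed simp

lemma coeff1_lln: "coeff1 lln n = lln_coeff n"
  unfolding lln_def
  by (rule coeff1_Abs, rule summableI_nonneg_bounded[OF _ sum_abs_lln_coeff_le]) simp

lemma norm_lln_le: "norm lln \<le> 1"
  by (rule norm_l1_le) (use sum_abs_lln_coeff_le in \<open>simp add: coeff1_lln\<close>)

text \<open>Both sides are determined by their values at real z, where the claim is the classical
  series of ln (1 + z/2).\<close>

lemma exp_lln: "exp lln = 1 + (1 / 2) *\<^sub>R lX"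
proof (rule l1_eqI_leval)
  fix z :: real assume z: "\<bar>z\<bar> < 1"
  then have nz: "norm z \<le> 1" by simp
  have "ln (1 + z / 2) = suminf (\<lambda>n. (-1) ^ n * (1 / real (n + 1)) * (z / 2) ^ Suc n)"
    using ln_series[of "1 + z / 2"] z by (simp add: abs_less_iff)
  also have "\<dots> = suminf (\<lambda>n. coeff1 lln (Suc n) *\<^sub>R z ^ Suc n)"
    by (intro arg_cong[where f = suminf] ext)
      (simp add: coeff1_lln lln_coeff_def field_simps power_mult_distrib power_minus')
  also have "\<dots> = leval z lln"
    using suminf_split_head[OF sums_summable[OF leval_sums[OF nz, of lln]]]
    by (simp add: leval_def coeff1_lln lln_coeff_def)
  finally have "exp (leval z lln) = exp (ln (1 + z / 2))" by simp
  then have "exp (leval z lln) = 1 + z / 2" using z by (simp add: abs_less_iff)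
  then show "leval z (exp lln) = leval z (1 + (1 / 2) *\<^sub>R lX)"
    by (simp add: leval_exp[OF nz] leval_add[OF nz] leval_scaleR[OF nz] leval_1[OF nz] leval_lX[OF nz])
qed

text \<open>\<open>lln\<close> is evaluated at 2 x, which explains the bound 1/2 on the norm;
  rescaling the fourth-order remainder costs 2^4 = 16. The linear bound on l holds because
  \<open>lln\<close> has no constant term.\<close>

lemma ex_log:
  fixes x :: "'a::{real_normed_algebra_1,banach}"
  assumes "norm x \<le> 1 / 2"
  obtains l r where "exp l = 1 + x" "norm l \<le> 2 * norm x" "norm r \<le> 16"
    "l = x - (1 / 2) *\<^sub>R x ^ 2 + (1 / 3) *\<^sub>R x ^ 3 + x ^ 4 * r"
proof -
  let ?y = "2 *\<^sub>R x"
  have y: "norm ?y \<le> 1" using assms by simp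
  define l where "l = leval ?y lln"
  define r where "r = 16 *\<^sub>R leval ?y ((lshift ^^ 4) lln)"
  have e: "exp l = 1 + x"
    unfolding l_def leval_exp[OF y, symmetric] exp_lln
    by (simp add: leval_add[OF y] leval_scaleR[OF y] leval_1[OF y] leval_lX[OF y])
  have sh: "norm ((lshift ^^ n) f) \<le> norm f" for n f
    by (induction n) (auto intro: order_trans[OF norm_lshift_le])
  have "norm r \<le> 16"
    using norm_leval_le[OF y, of "(lshift ^^ 4) lln"] sh[of 4 lln] norm_lln_le by (simp add: r_def)
  moreover have "norm l \<le> 2 * norm x"
  proof -
    have "l = ?y * leval ?y (lshift lln)"
      unfolding l_def by (subst l1_split[of lln])
        (simp add: leval_add[OF y] leval_scaleR[OF y] leval_1[OF y] leval_lX[OF y] leval_mult[OF y]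
          coeff1_lln lln_coeff_def)
    also have "norm \<dots> \<le> norm ?y * norm (leval ?y (lshift lln))"
      by (rule norm_mult_ineq)
    also have "\<dots> \<le> norm ?y * 1"
      using norm_leval_le[OF y, of "lshift lln"] norm_lshift_le[of lln] norm_lln_le
      by (intro mult_left_mono) auto
    finally show ?thesis by simp
  qed
  moreover have "l = x - (1 / 2) *\<^sub>R x ^ 2 + (1 / 3) *\<^sub>R x ^ 3 + x ^ 4 * r"
    unfolding l_def r_def by (subst leval_split4[OF y]) (simp add: coeff1_lln lln_coeff_def power_divide)
  ultimately show ?thesis using e that by blast
qed

section \<open>The generating function of the number of runs and its logarithm\<close>

text \<open>The coefficient counts the placements of $r$ disjoint blocks of length $m$ in a row of length $n$;
  the truncated subtraction is harmless, as the coefficient vanishes for $r > 0$ and $n < mr$.\<close>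

definition run_gf :: "nat \<Rightarrow> 'a::comm_ring_1 \<Rightarrow> nat \<Rightarrow> 'a" where
  "run_gf m u n = (\<Sum>r\<le>n. of_nat ((n - (m - 1) * r) choose r) * u ^ r)"

lemma run_gf_extend:
  assumes "n \<le> K"
  shows "run_gf m u n = (\<Sum>r\<le>K. of_nat ((n - (m - 1) * r) choose r) * u ^ r)"
  unfolding run_gf_def
proof (rule sum.mono_neutral_left)
  show "\<forall>i\<in>{..K} - {..n}. of_nat ((n - (m - 1) * i) choose i) * u ^ i = 0"
  proof
    fix i assume "i \<in> {..K} - {..n}"
    then have "n - (m - 1) * i < i" by auto
    then show "of_nat ((n - (m - 1) * i) choose i) * u ^ i = 0"
      by (simp add: binomial_eq_0)
  qed
qed (use assms in auto)

lemma run_gf_init: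
  assumes "n < m"
  shows "run_gf m u n = 1"
proof -
  have "(n - (m - 1) * r) choose r = (if r = 0 then 1 else 0)" for r
  proof (cases r)
    case (Suc s)
    then have "n - (m - 1) * r = 0" using assms by (cases m) (auto simp: algebra_simps)
    then show ?thesis using Suc by simp
  qed simp
  then show ?thesis unfolding run_gf_def by (simp add: if_distrib[of of_nat] if_distrib[of "\<lambda>x. x * _"] cong: if_cong)
qed

text \<open>Pascal's rule in each power of u: the last position either is free or ends a
  block.\<close>

lemma run_gf_rec:
  assumes "1 \<le> m" "m \<le> n"
  shows "run_gf m u n = run_gf m u (n - 1) + u * run_gf m u (n - m)"
proof -
  obtain k where n: "n = Suc k" using assms by (cases n) auto
  define b where "b j r = (of_nat ((j - (m - 1) * r) choose r) :: 'a)" for j r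
  have key: "b n (Suc r) = b k (Suc r) + b (n - m) r" for r
  \<comment> \<open>If the truncated difference is 0, then m \<le> n forces r > 0 and all three
    binomials are 0 over a positive number; otherwise Pascal's rule applies literally.\<close>
  proof (cases "n - (m - 1) * Suc r")
    case 0
    then have "n - m - (m - 1) * r = 0" "k - (m - 1) * Suc r = 0"
      using assms n by (auto simp: algebra_simps)
    moreover have "r \<noteq> 0" using 0 assms by (auto intro: ccontr)
    ultimately show ?thesis using 0 by (cases r) (auto simp: b_def)
  next
    case (Suc N)
    then have "n - m - (m - 1) * r = N" "k - (m - 1) * Suc r = N"
      using assms n by (cases m; auto simp: algebra_simps)+
    then show ?thesis unfolding b_def Suc by simp
  qed
  have "run_gf m u n = b n 0 + (\<Sum>r\<le>k. b n (Suc r) * u ^ Suc r)"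
    unfolding run_gf_def n b_def by (subst sum.atMost_Suc_shift) simp
  also have "\<dots> = (b k 0 + (\<Sum>r\<le>k. b k (Suc r) * u ^ Suc r)) + u * (\<Sum>r\<le>k. b (n - m) r * u ^ r)"
    unfolding key by (simp add: sum.distrib sum_distrib_left algebra_simps b_def)
  also have "b k 0 + (\<Sum>r\<le>k. b k (Suc r) * u ^ Suc r) = (\<Sum>r\<le>Suc k. b k r * u ^ r)"
    by (subst sum.atMost_Suc_shift) simp
  also have "\<dots> = run_gf m u k"
    unfolding b_def by (rule run_gf_extend[symmetric]) simp
  also have "(\<Sum>r\<le>k. b (n - m) r * u ^ r) = run_gf m u (n - m)"
    unfolding b_def by (rule run_gf_extend[symmetric]) (use assms n in auto)
  finally show ?thesis using n by simp
qed

lemma exp_neg_mult: "exp (- x) * exp x = (1 :: 'a::{comm_ring_1,real_normed_algebra_1,banach})"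
  using exp_add_commuting[of "- x" x] by (simp add: mult.commute)

text \<open>The recursion reads F_n = F_{n-1} (1 + u F_{n-m} / F_{n-1}). By induction the inner
  quotient is exp (- l) with l a sum of m - 1 earlier logarithms, so norm l \<le> 4 m norm u \<le>
  1/2. Then exp (- l) has norm at most 2, the perturbation x at most 2 norm u, and its logarithm at
  most 4 norm u, which closes the induction. Writing quotients as exponentials makes them invertible
  for free.\<close>

lemma run_gf_factor:
  fixes u :: "'a::{comm_ring_1,real_normed_algebra_1,banach}"
  assumes m: "1 \<le> m" and u: "8 * real m * norm u \<le> 1" and n: "1 \<le> n"
  shows "\<exists>l. norm l \<le> 4 * norm u \<and> run_gf m u n = run_gf m u (n - 1) * exp l"
  using n
proof (induction n rule: less_induct)
  case (less n)
  show ?case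
  proof (cases "n < m")
    case True
    then show ?thesis by (intro exI[of _ 0]) (simp add: run_gf_init)
  next
    case False
    \<comment> \<open>The induction hypothesis is chained over i consecutive indices; i = m - 1
      leads from n - 1 down to n - m.\<close>
    have "\<exists>l. norm l \<le> real i * (4 * norm u) \<and> run_gf m u (n - 1) = run_gf m u (n - 1 - i) * exp l"
      if "i < n" for i
      using that
    proof (induction i)
      case 0
      show ?case by (intro exI[of _ 0]) simp
    next
      case (Suc i)
      then obtain l where l: "norm l \<le> real i * (4 * norm u)"
        "run_gf m u (n - 1) = run_gf m u (n - 1 - i) * exp l" by auto
      have "n - 1 - i < n" "1 \<le> n - 1 - i" using Suc.prems by arith+
      then obtain l' where l': "norm l' \<le> 4 * norm u"
        "run_gf m u (n - 1 - i) = run_gf m u (n - 1 - i - 1) * exp l'"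
        using less.IH by blast
      show ?case
        by (rule exI[of _ "l' + l"])
          (use l l' norm_triangle_ineq[of l' l] in
            \<open>simp add: exp_add_commuting mult.commute mult.assoc algebra_simps\<close>)
    qed
    moreover have "m - 1 < n" "n - 1 - (m - 1) = n - m" using False m by arith+
    ultimately obtain l where l: "norm l \<le> real (m - 1) * (4 * norm u)"
      "run_gf m u (n - 1) = run_gf m u (n - m) * exp l" by metis
    define x where "x = u * exp (- l)"
    have "norm l \<le> 1 / 2"
    proof -
      have "real (m - 1) * norm u \<le> real m * norm u" by (intro mult_right_mono) auto
      then show ?thesis using l(1) u by linarith
    qed
    then have "norm (exp (- l)) \<le> 2"
      using norm_exp[of "- l"] exp_bound_half[of "norm l"] by simp
    then have xu: "norm x \<le> 2 * norm u"
      using norm_mult_ineq[of u "exp (- l)"] mult_left_mono[of "norm (exp (- l))" 2 "norm u"]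
      by (simp add: x_def)
    have "norm u \<le> 1 / 8"
      using mult_right_mono[of 1 "real m" "norm u"] m u by auto
    then have "norm x \<le> 1 / 2" using xu by linarith
    then obtain l2 where l2: "exp l2 = 1 + x" "norm l2 \<le> 2 * norm x"
      by (rule ex_log)
    have "run_gf m u n = run_gf m u (n - 1) + u * run_gf m u (n - m)"
      using False m by (intro run_gf_rec) auto
    also have "run_gf m u (n - m) = run_gf m u (n - 1) * exp (- l)"
      unfolding l(2) by (simp add: mult.assoc exp_neg_mult[of "- l", simplified])
    also have "run_gf m u (n - 1) + u * (run_gf m u (n - 1) * exp (- l)) = run_gf m u (n - 1) * exp l2"
      by (simp add: l2 x_def algebra_simps)
    finally show ?thesis using l2(2) xu by (intro exI[of _ l2]) auto
  qed
qed

text \<open>The count starts at m - 1, the last index with value 1, so k is the number n - m + 1 of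
  possible end positions.\<close>

lemma run_gf_exp:
  fixes u :: "'a::{comm_ring_1,real_normed_algebra_1,banach}"
  assumes m: "1 \<le> m" and u: "8 * real m * norm u \<le> 1"
  shows "\<exists>g. norm g \<le> 4 * real k * norm u \<and> run_gf m u (m - 1 + k) = exp g"
proof (induction k)
  case 0
  show ?case by (intro exI[of _ 0]) (use m in \<open>simp add: run_gf_init\<close>)
next
  case (Suc k)
  then obtain g where g: "norm g \<le> 4 * real k * norm u" "run_gf m u (m - 1 + k) = exp g" by blast
  obtain l where l: "norm l \<le> 4 * norm u" "run_gf m u (m - 1 + Suc k) = run_gf m u (m - 1 + k) * exp l"
    using run_gf_factor[OF m u, of "m - 1 + Suc k"] by auto
  show ?case
    by (rule exI[of _ "g + l"])
      (use g l norm_triangle_ineq[of g l] in \<open>simp add: exp_add_commuting mult.commute algebra_simps\<close>)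
qed

section \<open>Taylor remainders of the exponential and low-order coefficients of the
  logarithm\<close>

definition exp_rem :: "nat \<Rightarrow> 'a::{real_normed_algebra_1,banach} \<Rightarrow> 'a" where
  "exp_rem k x = suminf (\<lambda>n. x ^ n /\<^sub>R fact (n + k))"

lemma summable_exp_rem:
  fixes x :: "'a::{real_normed_algebra_1,banach}"
  shows "summable (\<lambda>n. norm (x ^ n /\<^sub>R fact (n + k)))"
proof (rule summable_comparison_test'[OF summable_norm_exp[of x], of 0])
  fix n
  have "inverse (fact (n + k) :: real) \<le> inverse (fact n)"
    by (intro le_imp_inverse_le fact_mono) auto
  then show "norm (norm (x ^ n /\<^sub>R fact (n + k))) \<le> norm (x ^ n /\<^sub>R fact n)"
    by (simp add: mult_right_mono)
qed

text \<open>Defining the remainder as a series, not as a quotient, makes x^k a factor even when x is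
  not invertible; the smoothing estimates act on this factor.\<close>

lemma exp_eq_exp_rem:
  fixes x :: "'a::{real_normed_algebra_1,banach}"
  shows "exp x = (\<Sum>n<k. x ^ n /\<^sub>R fact n) + x ^ k * exp_rem k x"
proof -
  have "exp x = (\<Sum>n<k. x ^ n /\<^sub>R fact n) + suminf (\<lambda>n. x ^ (n + k) /\<^sub>R fact (n + k))"
    unfolding exp_def by (subst suminf_split_initial_segment[OF summable_norm_cancel[OF summable_norm_exp], of _ k])
      (simp add: add.commute)
  also have "suminf (\<lambda>n. x ^ (n + k) /\<^sub>R fact (n + k)) = x ^ k * exp_rem k x"
    unfolding exp_rem_def
    by (subst suminf_mult[OF summable_norm_cancel[OF summable_exp_rem], symmetric])
      (simp add: power_add power_commutes flip: power_add, simp add: add.commute)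
  finally show ?thesis .
qed

lemma leval_0: "leval (0::real) f = coeff1 f 0"
  unfolding leval_def by (subst suminf_finite[of "{0}"]) auto

lemma coeff1_lX_power_mult: "coeff1 (lX ^ r * f) n = (if n < r then 0 else coeff1 f (n - r))"
  by (induction r arbitrary: n) (auto simp: coeff1_lX_mult mult.assoc)

lemma coeff1_sum: "coeff1 (sum f I) n = (\<Sum>i\<in>I. coeff1 (f i) n)"
  by (induction I rule: infinite_finite_induct) auto

text \<open>Without constant term g is divisible by \<open>lX\<close>, so the remainder of order 4
  does not reach the coefficients below index 4 and only the Taylor polynomial counts.\<close>

lemma coeff1_exp:
  assumes "coeff1 g 0 = 0"
  shows "coeff1 (exp g) 1 = coeff1 g 1"
    "coeff1 (exp g) 2 = coeff1 g 2 + (coeff1 g 1)\<^sup>2 / 2"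
    "coeff1 (exp g) 3 = coeff1 g 3 + coeff1 g 1 * coeff1 g 2 + (coeff1 g 1) ^ 3 / 6"
proof -
  have "g = lX * lshift g"
    using l1_split[of g] assms by simp
  then have "g ^ 4 * exp_rem 4 g = lX ^ 4 * (lshift g ^ 4 * exp_rem 4 g)"
    by (metis power_mult_distrib mult.assoc)
  then have rem: "coeff1 (g ^ 4 * exp_rem 4 g) n = 0" if "n < 4" for n
    using that by (simp add: coeff1_lX_power_mult)
  have e: "coeff1 (exp g) n = coeff1 1 n + coeff1 g n + coeff1 (g * g) n / 2 + coeff1 (g * (g * g)) n / 6"
    if "n < 4" for n
  proof -
    have "(\<Sum>n<4. g ^ n /\<^sub>R fact n) = 1 + g + (1 / 2) *\<^sub>R (g * g) + (1 / 6) *\<^sub>R (g * (g * g))"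
      by (simp add: eval_nat_numeral field_simps)
    then show ?thesis
      unfolding exp_eq_exp_rem[of g 4] coeff1_simps rem[OF that] by simp
  qed
  show "coeff1 (exp g) 1 = coeff1 g 1"
    "coeff1 (exp g) 2 = coeff1 g 2 + (coeff1 g 1)\<^sup>2 / 2"
    "coeff1 (exp g) 3 = coeff1 g 3 + coeff1 g 1 * coeff1 g 2 + (coeff1 g 1) ^ 3 / 6"
    by (simp_all add: e coeff1_mult assms numeral_eq_Suc atMost_Suc field_simps)
qed

lemma coeff1_of_nat_mult: "coeff1 (of_nat c * f) n = real c * coeff1 f n"
  by (induction c) (auto simp: algebra_simps)

lemma coeff1_run_gf:
  assumes "i \<le> n"
  shows "coeff1 (run_gf m (R *\<^sub>R lX) n) i = real ((n - (m - 1) * i) choose i) * R ^ i"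
proof -
  have "coeff1 (run_gf m (R *\<^sub>R lX) n) i =
    (\<Sum>r\<le>n. if i = r then real ((n - (m - 1) * r) choose r) * R ^ r else 0)"
    unfolding run_gf_def coeff1_sum
    by (intro sum.cong) (auto simp: coeff1_of_nat_mult coeff1_lX_power)
  then show ?thesis using assms by simp
qed

lemma leval_run_gf:
  assumes "norm (y :: 'a::{comm_ring_1,real_normed_algebra_1,banach}) \<le> 1"
  shows "leval y (run_gf m f n) = run_gf m (leval y f) n"
proof -
  have of_nat: "leval y (of_nat c * f) = of_nat c * leval y f" for c f
    by (induction c) (use leval_scaleR[OF assms, of 0 0] in
        \<open>auto simp: distrib_right leval_add[OF assms]\<close>)
  show ?thesis
    unfolding run_gf_def
    by (simp add: linear_sum[OF bounded_linear.linear[OF bounded_linear_leval[OF assms]]]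
        of_nat leval_power[OF assms])
qed

lemma binomial_3: "real (N choose 3) = real N * (real N - 1) * (real N - 2) / 6"
  by (simp add: binomial_gbinomial gbinomial_prod_rev numeral_3_eq_3 fact_numeral)

lemma binomial_2: "real (N choose 2) = real N * (real N - 1) / 2"
  by (simp add: binomial_gbinomial gbinomial_prod_rev numeral_2_eq_2 fact_numeral)

text \<open>The logarithm is taken once, for the argument \<open>R *\<^sub>R lX\<close> with R =
  1/(8m), the largest scale that \<open>run_gf_exp\<close> admits, and is carried to x by evaluation
  at x / R. The remainder bound is a Cauchy estimate: norm g \<le> 4 k R, and 4 k R / R^4 = 4 k
  (8m)^3 = 2048 k m^3.\<close>

lemma run_gf_log:
  fixes x :: "'a::{comm_ring_1,real_normed_algebra_1,banach}"
  assumes m: "2 \<le> m" and k: "2 * m \<le> k" and x: "8 * real m * norm x \<le> 1"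
  defines "c2 \<equiv> - (real k * (2 * real m - 1) - real m * (real m - 1)) / 2"
  defines "c3 \<equiv> (real k * (3 * real m - 1) * (3 * real m - 2)
      - 4 * real m * (2 * real m - 1) * (real m - 1)) / 6"
  obtains t where "norm t \<le> 2048 * real k * real m ^ 3"
    "run_gf m x (m - 1 + k) = exp (real k *\<^sub>R x + c2 *\<^sub>R x ^ 2 + c3 *\<^sub>R x ^ 3 + x ^ 4 * t)"
proof -
  define R where "R = 1 / (8 * real m)"
  have R: "R > 0" "8 * real m * R = 1" using m by (auto simp: R_def)
  define n where "n = m - 1 + k"
  have "8 * real m * norm (R *\<^sub>R lX) \<le> 1" using R by (simp add: norm_lX)
  from run_gf_exp[OF _ this, of k] obtain g where
    g: "norm g \<le> 4 * real k * R" "run_gf m (R *\<^sub>R lX) n = exp g"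
    using R m by (auto simp: norm_lX n_def)
  \<comment> \<open>The constant term of g is read off in the reals, where the exponential is
    injective.\<close>
  have "exp (leval (0::real) g) = leval 0 (exp g)"
    by (rule leval_exp[symmetric]) simp
  also have "\<dots> = 1"
    unfolding leval_0 g(2)[symmetric] by (subst coeff1_run_gf) auto
  finally have g0: "coeff1 g 0 = 0" by (simp add: leval_0)
  \<comment> \<open>With n = m - 1 + k the top n - (m-1) r becomes k - (m-1)(r-1); 2 m \<le> k makes
    these truncated differences genuine.\<close>
  have n3: "3 \<le> n" "n - (m - 1) * 3 = k - 2 * (m - 1)" "n - (m - 1) * 2 = k - (m - 1)" "n - (m - 1) = k"
    using m k by (auto simp: n_def)
  have g1: "coeff1 g 1 = real k * R"
    using coeff1_exp(1)[OF g0] n3 unfolding g(2)[symmetric] by (subst (asm) coeff1_run_gf) auto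
  have sub: "real (k - (m - 1)) = real k - real m + 1" "real (k - 2 * (m - 1)) = real k - 2 * real m + 2"
    using m k by auto
  have "coeff1 (exp g) 2 = real ((n - (m - 1) * 2) choose 2) * R ^ 2"
    unfolding g(2)[symmetric] using n3 by (intro coeff1_run_gf) simp
  then have "coeff1 (exp g) 2 = (real k - real m + 1) * (real k - real m) / 2 * R ^ 2"
    unfolding n3 binomial_2 sub by simp
  then have g2: "coeff1 g 2 = c2 * R ^ 2"
    unfolding coeff1_exp(2)[OF g0] g1 c2_def by (simp add: field_simps power2_eq_square)
  have "coeff1 (exp g) 3 = real ((n - (m - 1) * 3) choose 3) * R ^ 3"
    unfolding g(2)[symmetric] using n3 by (intro coeff1_run_gf) simp
  then have "coeff1 (exp g) 3 =
      (real k - 2 * real m + 2) * (real k - 2 * real m + 1) * (real k - 2 * real m) / 6 * R ^ 3"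
    unfolding n3 binomial_3 sub by (simp add: add.commute diff_add_eq)
  then have "coeff1 g 3 = (real k - 2 * real m + 2) * (real k - 2 * real m + 1) * (real k - 2 * real m) / 6 * R ^ 3
      - real k * R * (c2 * R ^ 2) - (real k * R) ^ 3 / 6"
    unfolding coeff1_exp(3)[OF g0] g1 g2 by simp
  also have "\<dots> = c3 * R ^ 3"
    unfolding c2_def c3_def by (simp add: field_simps power2_eq_square power3_eq_cube)
  finally have g3: "coeff1 g 3 = c3 * R ^ 3" .
  define y where "y = (1 / R) *\<^sub>R x"
  have y: "norm y \<le> 1" using x R by (simp add: y_def R_def)
  have xy: "x = R *\<^sub>R y" using R by (simp add: y_def)
  define t where "t = (1 / R) ^ 4 *\<^sub>R leval y ((lshift ^^ 4) g)"
  have sh: "norm ((lshift ^^ j) f) \<le> norm f" for j f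
    by (induction j) (auto intro: order_trans[OF norm_lshift_le])
  have "norm t \<le> (1 / R) ^ 4 * (4 * real k * R)"
    unfolding t_def norm_scaleR
    by (rule mult_mono) (use R norm_leval_le[OF y, of "(lshift ^^ 4) g"] sh[of 4 g] g(1) in auto)
  also have "\<dots> = 2048 * real k * real m ^ 3"
    using m by (simp add: R_def field_simps eval_nat_numeral)
  finally have t: "norm t \<le> 2048 * real k * real m ^ 3" .
  have "run_gf m x (m - 1 + k) = run_gf m (leval y (R *\<^sub>R lX)) n"
    by (simp add: n_def xy leval_scaleR[OF y] leval_lX[OF y])
  also have "\<dots> = exp (leval y g)"
    by (simp add: leval_run_gf[OF y, symmetric] g(2) leval_exp[OF y])
  also have "leval y g = real k *\<^sub>R x + c2 *\<^sub>R x ^ 2 + c3 *\<^sub>R x ^ 3 + x ^ 4 * t"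
    using R by (subst leval_split4[OF y]) (simp add: g0 g1[simplified] g2 g3 xy t_def power_divide)
  finally show ?thesis using that t by blast
qed

section \<open>Smoothing by the Poisson semigroup\<close>

definition lw :: l1 where "lw = lX - 1"

lemma exp_scaleR_1: "exp (c *\<^sub>R 1) = exp c *\<^sub>R (1 :: 'a::{real_normed_algebra_1,banach})"
proof -
  have "(\<lambda>n. (c ^ n /\<^sub>R fact n) *\<^sub>R (1::'a)) sums (exp c *\<^sub>R 1)"
    by (rule bounded_linear.sums[OF bounded_linear_scaleR_left exp_converges])
  moreover have "(\<lambda>n. (c *\<^sub>R (1::'a)) ^ n /\<^sub>R fact n) sums exp (c *\<^sub>R 1)"
    by (rule exp_converges)
  ultimately show ?thesis by (simp add: sums_iff)
qed

lemma exp_power_nat: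
  fixes x :: "'a::{real_normed_algebra_1,banach}"
  shows "exp x ^ n = exp (real n *\<^sub>R x)"
proof (induction n)
  case (Suc n)
  then show ?case
    using exp_add_commuting[of x "real n *\<^sub>R x"] by (simp add: algebra_simps)
qed simp

lemma coeff1_exp_lX: "coeff1 (exp (t *\<^sub>R lX)) n = t ^ n / fact n"
proof -
  have "(\<lambda>k. coeff1 ((t *\<^sub>R lX) ^ k /\<^sub>R fact k) n) sums coeff1 (exp (t *\<^sub>R lX)) n"
    by (rule bounded_linear.sums[OF bounded_linear_coeff1 exp_converges])
  moreover have "(\<lambda>k. coeff1 ((t *\<^sub>R lX) ^ k /\<^sub>R fact k) n) = (\<lambda>k. if k = n then t ^ k / fact k else 0)"
    by (auto simp: coeff1_lX_power divide_inverse)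
  moreover have "(\<lambda>k. if k = n then t ^ k / fact k else 0) sums (t ^ n / fact n)"
    by (rule sums_single)
  ultimately show ?thesis by (metis sums_unique2)
qed

definition poisson_mass :: "real \<Rightarrow> nat \<Rightarrow> real" where
  "poisson_mass t n = exp (- t) * t ^ n / fact n"

lemma coeff1_exp_lw: "coeff1 (exp (t *\<^sub>R lw)) n = poisson_mass t n"
proof -
  have "exp (t *\<^sub>R lw) = exp (t *\<^sub>R lX + (- t) *\<^sub>R 1)"
    by (simp add: lw_def algebra_simps)
  also have "\<dots> = exp (- t) *\<^sub>R exp (t *\<^sub>R lX)"
    by (subst exp_add_commuting) (simp_all add: exp_scaleR_1 del: scaleR_minus_left)
  finally show ?thesis by (simp add: coeff1_exp_lX poisson_mass_def)
qed

lemma poisson_mass_nonneg: "0 \<le> t \<Longrightarrow> 0 \<le> poisson_mass t n"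
  by (simp add: poisson_mass_def)

lemma poisson_mass_sums: "poisson_mass t sums 1"
proof -
  have "(\<lambda>n. exp (- t) * (t ^ n /\<^sub>R fact n)) sums (exp (- t) * exp t)"
    by (rule sums_mult[OF exp_converges])
  then show ?thesis by (simp add: poisson_mass_def[abs_def] divide_inverse mult_ac flip: exp_add)
qed

lemma poisson_mass_Suc: "0 < t \<Longrightarrow> poisson_mass t (Suc n) * real (Suc n) = t * poisson_mass t n"
  by (simp add: poisson_mass_def del: of_nat_Suc)

lemma norm_exp_lw: "0 \<le> t \<Longrightarrow> norm (exp (t *\<^sub>R lw)) = 1"
  using poisson_mass_sums[of t] by (simp add: norm_l1_altdef coeff1_exp_lw poisson_mass_nonneg sums_iff)

lemma poisson_mass_moment1:
  assumes "0 < t"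
  shows "(\<lambda>n. real n * poisson_mass t n) sums t"
proof -
  have "(\<lambda>n. real (Suc n) * poisson_mass t (Suc n)) sums (t * 1)"
    using sums_mult[OF poisson_mass_sums, of t t] assms by (simp only: mult.commute[of "real _"] poisson_mass_Suc)
  then show ?thesis by (subst (asm) sums_Suc_iff) simp
qed

text \<open>The deviation is normalised by t because n / t - 1 is the ratio of the coefficients of
  \<open>lw * exp (t *\<^sub>R lw)\<close> to the Poisson masses. The second factorial moment
  reduces to the mean by an index shift.\<close>

lemma poisson_mass_variance:
  assumes "0 < t"
  shows "(\<lambda>n. poisson_mass t n * (real n / t - 1)\<^sup>2) sums (1 / t)"
proof -
  have "(\<lambda>n. real (Suc n) * (real (Suc n) - 1) * poisson_mass t (Suc n)) sums (t * t)"
  proof -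
    have eq: "real (Suc n) * (real (Suc n) - 1) * poisson_mass t (Suc n) = t * (real n * poisson_mass t n)" for n
    proof -
      have "real (Suc n) * (real (Suc n) - 1) * poisson_mass t (Suc n) =
          real n * (poisson_mass t (Suc n) * real (Suc n))" by simp
      then show ?thesis by (simp only: poisson_mass_Suc[OF assms] mult.left_commute)
    qed
    show ?thesis unfolding eq by (rule sums_mult[OF poisson_mass_moment1[OF assms]])
  qed
  then have m2: "(\<lambda>n. real n * (real n - 1) * poisson_mass t n) sums (t * t)"
    by (subst (asm) sums_Suc_iff) simp
  have "(\<lambda>n. real n * (real n - 1) * poisson_mass t n * (1 / t\<^sup>2) +
      real n * poisson_mass t n * (1 / t\<^sup>2 - 2 / t) + poisson_mass t n)
      sums (t * t * (1 / t\<^sup>2) + t * (1 / t\<^sup>2 - 2 / t) + 1)"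
    by (intro sums_add sums_mult2 m2 poisson_mass_moment1 assms poisson_mass_sums)
  moreover have "t * t * (1 / t\<^sup>2) + t * (1 / t\<^sup>2 - 2 / t) + 1 = 1 / t"
    using assms by (simp add: field_simps power2_eq_square)
  moreover have "(\<lambda>n. real n * (real n - 1) * poisson_mass t n * (1 / t\<^sup>2) +
      real n * poisson_mass t n * (1 / t\<^sup>2 - 2 / t) + poisson_mass t n) =
      (\<lambda>n. poisson_mass t n * (real n / t - 1)\<^sup>2)"
    using assms by (intro ext) (simp add: field_simps power2_eq_square)
  ultimately show ?thesis by simp
qed

lemma coeff1_lw_mult: "coeff1 (lw * f) n = (if n = 0 then 0 else coeff1 f (n - 1)) - coeff1 f n"
  by (simp add: lw_def left_diff_distrib coeff1_lX_mult)

lemma norm_lw_exp_lw: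
  assumes "0 < t"
  shows "norm (lw * exp (t *\<^sub>R lw)) \<le> 1 / sqrt t"
proof (rule norm_l1_le)
  fix N
  have c: "coeff1 (lw * exp (t *\<^sub>R lw)) n = poisson_mass t n * (real n / t - 1)" for n
  proof (cases n)
    case (Suc k)
    then show ?thesis
      using poisson_mass_Suc[OF assms, of k] assms
      by (simp add: coeff1_lw_mult coeff1_exp_lw field_simps)
  qed (simp add: coeff1_lw_mult coeff1_exp_lw)
  \<comment> \<open>A weighted AM-GM inequality replaces Cauchy-Schwarz. The weight sqrt t is the
    balanced one: as the variance is 1 / t, both halves contribute 1 / sqrt t.\<close>
  have sums: "(\<lambda>n. (sqrt t * (poisson_mass t n * (real n / t - 1)\<^sup>2) + 1 / sqrt t * poisson_mass t n) / 2)
      sums ((sqrt t * (1 / t) + 1 / sqrt t * 1) / 2)"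
    by (intro sums_divide sums_add sums_mult poisson_mass_variance poisson_mass_sums assms)
  have "(\<Sum>n<N. \<bar>coeff1 (lw * exp (t *\<^sub>R lw)) n\<bar>) \<le>
      (\<Sum>n<N. (sqrt t * (poisson_mass t n * (real n / t - 1)\<^sup>2) + 1 / sqrt t * poisson_mass t n) / 2)"
  proof (rule sum_mono)
    fix n
    have amgm: "\<bar>x\<bar> \<le> (s * x\<^sup>2 + 1 / s) / 2" if "s > 0" for s x :: real
    proof -
      have "0 \<le> (s * \<bar>x\<bar> - 1)\<^sup>2 / s" using that by simp
      also have "\<dots> = s * x\<^sup>2 + 1 / s - 2 * \<bar>x\<bar>"
        using that by (simp add: field_simps power2_eq_square)
      finally show ?thesis by simp
    qed
    have "\<bar>coeff1 (lw * exp (t *\<^sub>R lw)) n\<bar> = poisson_mass t n * \<bar>real n / t - 1\<bar>"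
      using assms by (simp add: c abs_mult poisson_mass_nonneg)
    also have "\<dots> \<le> poisson_mass t n * ((sqrt t * (real n / t - 1)\<^sup>2 + 1 / sqrt t) / 2)"
      using assms by (intro mult_left_mono amgm poisson_mass_nonneg) auto
    finally show "\<bar>coeff1 (lw * exp (t *\<^sub>R lw)) n\<bar> \<le>
        (sqrt t * (poisson_mass t n * (real n / t - 1)\<^sup>2) + 1 / sqrt t * poisson_mass t n) / 2"
      by (simp add: algebra_simps add_divide_distrib)
  qed
  also have "\<dots> \<le> (sqrt t * (1 / t) + 1 / sqrt t * 1) / 2"
    using sum_le_suminf[OF sums_summable[OF sums], of "{..<N}"] assms sums_unique[OF sums]
    by (simp add: poisson_mass_nonneg)
  also have "\<dots> = 1 / sqrt t"
    using assms by (simp add: real_sqrt_divide field_simps)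
  finally show "(\<Sum>n<N. \<bar>coeff1 (lw * exp (t *\<^sub>R lw)) n\<bar>) \<le> 1 / sqrt t" .
qed

lemma norm_lw_power_exp_lw:
  assumes "0 < t"
  shows "norm (lw ^ j * exp (t *\<^sub>R lw)) \<le> sqrt (real j / t) ^ j"
proof (cases "j = 0")
  case True
  then show ?thesis using assms by (simp add: norm_exp_lw)
next
  case False
  \<comment> \<open>Each factor \<open>lw\<close> receives the share t / j of the Poisson
    time.\<close>
  have "lw ^ j * exp (t *\<^sub>R lw) = (lw * exp ((t / real j) *\<^sub>R lw)) ^ j"
    using False by (simp add: power_mult_distrib exp_power_nat)
  then have "norm (lw ^ j * exp (t *\<^sub>R lw)) \<le> norm (lw * exp ((t / real j) *\<^sub>R lw)) ^ j"
    using norm_power_ineq by metis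
  also have "\<dots> \<le> (1 / sqrt (t / real j)) ^ j"
    using False assms by (intro power_mono norm_lw_exp_lw) auto
  also have "1 / sqrt (t / real j) = sqrt (real j / t)"
    by (simp add: real_sqrt_divide)
  finally show ?thesis .
qed

section \<open>Exponents of order w^2 absorbed by the Poisson factor\<close>

lemma power_self_le_exp_fact: "real j ^ j \<le> exp (real j) * fact j"
proof -
  have "real j ^ j /\<^sub>R fact j \<le> exp (real j)"
    unfolding exp_def
    using sum_le_suminf[OF summable_norm_cancel[OF summable_norm_exp[of "real j"]], of "{j}"] by simp
  then show ?thesis by (simp add: field_simps)
qed

text \<open>The $j$-th term is smoothed by splitting the Poisson factor into $2j$ equal parts, and
  $j^j / j! \le e^j$ turns the resulting bound into a geometric series.\<close>

lemma norm_exp_lw_series: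
  assumes t: "0 < t" and v: "33 * norm v \<le> 4 * t" and b: "\<And>j. \<bar>b j\<bar> \<le> 1 / fact j"
  shows "norm (exp (t *\<^sub>R lw) * suminf (\<lambda>j. b j *\<^sub>R (lw ^ 2 * v) ^ j)) \<le> 3"
proof -
  have sm: "summable (\<lambda>j. norm (b j *\<^sub>R (lw ^ 2 * v) ^ j))"
  proof (rule summable_comparison_test'[OF summable_norm_exp[of "lw ^ 2 * v"], of 0])
    fix j
    show "norm (norm (b j *\<^sub>R (lw ^ 2 * v) ^ j)) \<le> norm ((lw ^ 2 * v) ^ j /\<^sub>R fact j)"
      using mult_right_mono[OF b[of j], of "norm ((lw ^ 2 * v) ^ j)"] by (simp add: divide_inverse)
  qed
  have tm: "norm (exp (t *\<^sub>R lw) * (b j *\<^sub>R (lw ^ 2 * v) ^ j)) \<le> (2 / 3) ^ j" for j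
  proof -
    have eq: "exp (t *\<^sub>R lw) * (b j *\<^sub>R (lw ^ 2 * v) ^ j) = b j *\<^sub>R (lw ^ (2 * j) * exp (t *\<^sub>R lw) * v ^ j)"
      unfolding power_mult[of lw 2 j] power_mult_distrib[of "lw ^ 2" v] by (simp only: mult_scaleR_right mult_ac)
    have "norm (exp (t *\<^sub>R lw) * (b j *\<^sub>R (lw ^ 2 * v) ^ j)) \<le>
        1 / fact j * (norm (lw ^ (2 * j) * exp (t *\<^sub>R lw)) * norm v ^ j)"
      unfolding eq using mult_mono[OF b[of j] order_trans[OF norm_mult_ineq[of "lw ^ (2 * j) * exp (t *\<^sub>R lw)" "v ^ j"]
            mult_left_mono[OF norm_power_ineq[of v j] norm_ge_zero]]]
      by simp
    also have "\<dots> \<le> 1 / fact j * ((2 * real j / t) ^ j * (4 * t / 33) ^ j)"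
    proof -
      have "norm (lw ^ (2 * j) * exp (t *\<^sub>R lw)) \<le> (2 * real j / t) ^ j"
        using norm_lw_power_exp_lw[OF t, of "2 * j"] t by (simp add: power_mult)
      moreover have "norm v ^ j \<le> (4 * t / 33) ^ j"
        using v by (intro power_mono) auto
      ultimately show ?thesis using t by (intro mult_left_mono mult_mono) auto
    qed
    also have "\<dots> = (8 / 33) ^ j * (real j ^ j / fact j)"
    proof -
      have "2 * real j / t * (4 * t / 33) = 8 / 33 * real j" using t by simp
      then have "(2 * real j / t) ^ j * (4 * t / 33) ^ j = (8 / 33) ^ j * real j ^ j"
        by (metis power_mult_distrib)
      then show ?thesis by simp
    qed
    also have "\<dots> \<le> (8 / 33) ^ j * exp (real j)"
      using power_self_le_exp_fact[of j] by (intro mult_left_mono) (auto simp: field_simps)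
    also have "\<dots> = (8 / 33 * exp 1) ^ j"
      using exp_of_nat_mult[of j "1 :: real"] by (simp only: power_mult_distrib mult_1_right)
    \<comment> \<open>8 e / 33 < 0.66: the ratio 4/33 in the hypothesis on v keeps the geometric
      ratio below 2/3, hence the final bound 3.\<close>
    also have "\<dots> \<le> (2 / 3) ^ j"
      using e_less_272 by (intro power_mono) auto
    finally show ?thesis .
  qed
  have g: "summable (\<lambda>j. (2 / 3 :: real) ^ j)" by (rule summable_geometric) simp
  have sn: "summable (\<lambda>j. norm (exp (t *\<^sub>R lw) * (b j *\<^sub>R (lw ^ 2 * v) ^ j)))"
    by (rule summable_comparison_test'[OF g, of 0]) (use tm in simp)
  have "exp (t *\<^sub>R lw) * suminf (\<lambda>j. b j *\<^sub>R (lw ^ 2 * v) ^ j) =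
      suminf (\<lambda>j. exp (t *\<^sub>R lw) * (b j *\<^sub>R (lw ^ 2 * v) ^ j))"
    by (rule suminf_mult[symmetric]) (rule summable_norm_cancel[OF sm])
  also have "norm \<dots> \<le> suminf (\<lambda>j. norm (exp (t *\<^sub>R lw) * (b j *\<^sub>R (lw ^ 2 * v) ^ j)))"
    by (rule summable_norm[OF sn])
  also have "\<dots> \<le> suminf (\<lambda>j. (2 / 3 :: real) ^ j)"
    by (rule suminf_le[OF tm sn g])
  also have "\<dots> = 3" by (subst suminf_geometric) auto
  finally show ?thesis .
qed

text \<open>Smoothing turns each \<open>lw ^ 2\<close> into a factor of order 1 / t, so v may be as
  large as a fixed fraction of t and the bound still does not depend on t.\<close>

lemma norm_exp_lw_exp:
  assumes "0 < t" "33 * norm v \<le> 4 * t"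
  shows "norm (exp (t *\<^sub>R lw) * exp (lw ^ 2 * v)) \<le> 3"
  using norm_exp_lw_series[OF assms, of "\<lambda>j. 1 / fact j"] by (simp add: exp_def divide_inverse)

text \<open>The coefficients 1 / (j + k)! are dominated by 1 / j!; the series bound allows arbitrary
  such coefficients so as to cover this case.\<close>

lemma norm_exp_lw_exp_rem:
  assumes "0 < t" "33 * norm v \<le> 4 * t"
  shows "norm (exp (t *\<^sub>R lw) * exp_rem k (lw ^ 2 * v)) \<le> 3"
proof -
  have "\<bar>1 / fact (j + k)\<bar> \<le> (1 / fact j :: real)" for j
    by (auto intro!: divide_left_mono fact_mono)
  then show ?thesis
    using norm_exp_lw_series[OF assms, of "\<lambda>j. 1 / fact (j + k)"] by (simp add: exp_rem_def divide_inverse)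
qed

lemma norm_lw: "norm lw \<le> 2"
  using norm_triangle_ineq4[of lX 1] by (simp add: lw_def norm_lX)

lemma norm_mult_le: "norm x \<le> a \<Longrightarrow> norm y \<le> b \<Longrightarrow> norm (x * y) \<le> a * b"
  for x y :: "'a::real_normed_algebra"
  by (rule order_trans[OF norm_mult_ineq]) (auto intro!: mult_mono order_trans[OF norm_ge_zero])

lemma exp_lw_split: "exp ((s + t) *\<^sub>R lw) = exp (s *\<^sub>R lw) * exp (t *\<^sub>R lw)"
  by (simp add: scaleR_add_left exp_add_commuting mult.commute)

text \<open>The Poisson time t is spent in portions: a quarter absorbs the exponential of
  \<open>lw ^ 2 * vQ\<close>, a quarter the Taylor remainder of the exponential of
  \<open>lw ^ 2 * vD\<close>, and the remaining half smooths explicit powers of \<open>lw\<close>.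
  The factor 132 = 4 * 33 is the absorption condition at time t / 4. \<open>vD\<close> enters twice:
  its norm controls the remainder, its decomposition gives the orders in t.\<close>

lemma exp_comparison:
  assumes t: "0 < t" and A: "0 \<le> A"
    and vQ: "132 * norm vQ \<le> 4 * t" and vD: "132 * norm vD \<le> 4 * t"
    and vD_eq: "vD = A *\<^sub>R lw + \<eta> + lw ^ 2 * \<theta>"
  defines "Q \<equiv> t *\<^sub>R lw + lw ^ 2 * vQ"
  shows "norm (exp Q * (A *\<^sub>R lw ^ 3)) \<le> 45 * A * sqrt (1 / t) ^ 3"
    and "norm (exp (Q + lw ^ 2 * vD) - exp Q * (1 + A *\<^sub>R lw ^ 3)) \<le>
      12 * norm \<eta> / t + 192 * norm \<theta> / t\<^sup>2 +
      27 * (1728 * A\<^sup>2 / t ^ 3 + 64 * (norm \<eta> / t)\<^sup>2 + 65536 * (norm \<theta> / t\<^sup>2)\<^sup>2)"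
proof -
  let ?E = "\<lambda>s. exp (s *\<^sub>R lw)"
  define D where "D = lw ^ 2 * vD"
  have expQ: "exp Q = ?E (t / 4) * exp (lw ^ 2 * vQ) * ?E (t / 4) * ?E (t / 2)"
  proof -
    have "?E t = ?E (t / 4) * ?E (t / 4) * ?E (t / 2)"
      using exp_lw_split[of "t / 2" "t / 2"] exp_lw_split[of "t / 4" "t / 4"] by simp
    moreover have "exp Q = ?E t * exp (lw ^ 2 * vQ)"
      unfolding Q_def by (rule exp_add_commuting) (simp add: mult.commute)
    ultimately show ?thesis by (simp only: mult_ac)
  qed
  have nQ: "norm (?E (t / 4) * exp (lw ^ 2 * vQ)) \<le> 3"
    by (rule norm_exp_lw_exp) (use t vQ in auto)
  have nR: "norm (?E (t / 4) * exp_rem 2 D) \<le> 3"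
    unfolding D_def by (rule norm_exp_lw_exp_rem) (use t vD in auto)
  have n1: "norm (?E (t / 4)) \<le> 1" using t by (simp add: norm_exp_lw)
  have pw: "norm (?E s * lw ^ j) \<le> sqrt (real j / s) ^ j" if "0 < s" for s j
    using norm_lw_power_exp_lw[OF that, of j] by (simp add: mult.commute)
  have p2: "norm (?E (t / 2) * lw ^ 2) \<le> 4 / t"
    using pw[of "t / 2" 2] t by simp
  have sq4: "sqrt x ^ 4 = x\<^sup>2" if "x \<ge> 0" for x :: real
    using that by (metis mult_2 numeral_Bit0 power_add power2_eq_square real_sqrt_pow2)
  have p4: "norm (?E (t / 2) * lw ^ 4) \<le> 64 / t\<^sup>2"
    using pw[of "t / 2" 4] t by (simp add: sq4 power_divide)
  have q2: "norm (?E (t / 4) * lw ^ 2) \<le> 8 / t"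
    using pw[of "t / 4" 2] t by simp
  have q3: "norm (?E (t / 4) * lw ^ 3) \<le> sqrt (12 / t) ^ 3"
    using pw[of "t / 4" 3] t by simp
  have q4: "norm (?E (t / 4) * lw ^ 4) \<le> 256 / t\<^sup>2"
    using pw[of "t / 4" 4] t by (simp add: sq4 power_divide)
  have base: "norm (?E (t / 4) * exp (lw ^ 2 * vQ) * ?E (t / 4)) \<le> 3"
    using norm_mult_le[OF nQ n1] by simp

  \<comment> \<open>At time t / 2 the third power costs (3 / (t/2))^(3/2), and 6^(3/2) < 15.\<close>
  have s6: "sqrt (6 / t) ^ 3 \<le> 15 * sqrt (1 / t) ^ 3"
  proof -
    have "sqrt (6 / t) = sqrt 6 * sqrt (1 / t)" by (simp add: real_sqrt_divide)
    moreover have "sqrt 6 ^ 3 \<le> (15 :: real)"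
    proof -
      have "sqrt 6 \<le> (2.45 :: real)" by (rule real_le_lsqrt) (auto simp: power2_eq_square)
      then have "sqrt 6 ^ 3 \<le> (2.45 :: real) ^ 3" by (intro power_mono) auto
      also have "\<dots> \<le> 15" by (simp add: power3_eq_cube)
      finally show ?thesis .
    qed
    ultimately show ?thesis using t by (auto simp: power_mult_distrib intro!: mult_right_mono)
  qed
  show "norm (exp Q * (A *\<^sub>R lw ^ 3)) \<le> 45 * A * sqrt (1 / t) ^ 3"
  proof -
    have "norm (?E (t / 2) * lw ^ 3) \<le> 15 * sqrt (1 / t) ^ 3"
      using pw[of "t / 2" 3] t s6 by simp
    then have "norm (A *\<^sub>R (?E (t / 2) * lw ^ 3)) \<le> A * (15 * sqrt (1 / t) ^ 3)"
      using A by (simp add: mult_left_mono)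
    from norm_mult_le[OF base this] show ?thesis
      unfolding expQ by (simp add: mult_ac)
  qed

  \<comment> \<open>Second order suffices: the linear part of D, less A w^3, and the square of D
    both have the target order after smoothing.\<close>
  have expD: "exp D = 1 + D + D ^ 2 * exp_rem 2 D"
    using exp_eq_exp_rem[of D 2] by (simp add: numeral_2_eq_2)
  have D_eq: "D = A *\<^sub>R lw ^ 3 + (lw ^ 2 * \<eta> + lw ^ 4 * \<theta>)"
    unfolding D_def vD_eq by (simp add: algebra_simps eval_nat_numeral)
  have "exp (Q + lw ^ 2 * vD) = exp Q * exp D"
    unfolding D_def by (rule exp_add_commuting) (simp add: mult.commute)
  moreover have "exp Q * D = exp Q * (A *\<^sub>R lw ^ 3) + exp Q * (lw ^ 2 * \<eta> + lw ^ 4 * \<theta>)"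
    by (subst D_eq) (rule distrib_left)
  ultimately have "exp (Q + lw ^ 2 * vD) - exp Q * (1 + A *\<^sub>R lw ^ 3) =
      exp Q * (lw ^ 2 * \<eta> + lw ^ 4 * \<theta>) + exp Q * (D ^ 2 * exp_rem 2 D)"
    by (simp only: expD distrib_left[of "exp Q" "1 + D"] distrib_left[of "exp Q" 1]) simp
  moreover have "norm (exp Q * (lw ^ 2 * \<eta> + lw ^ 4 * \<theta>)) \<le> 3 * (4 / t * norm \<eta> + 64 / t\<^sup>2 * norm \<theta>)"
  proof -
    have "exp Q * (lw ^ 2 * \<eta> + lw ^ 4 * \<theta>) = (?E (t / 4) * exp (lw ^ 2 * vQ) * ?E (t / 4)) *
        (?E (t / 2) * lw ^ 2 * \<eta> + ?E (t / 2) * lw ^ 4 * \<theta>)"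
      unfolding expQ by (simp only: mult.assoc distrib_left)
    also have "norm \<dots> \<le> 3 * (4 / t * norm \<eta> + 64 / t\<^sup>2 * norm \<theta>)"
      by (intro norm_mult_le base order_trans[OF norm_triangle_ineq] add_mono p2 p4 order_refl)
    finally show ?thesis .
  qed
  moreover have "norm (exp Q * (D ^ 2 * exp_rem 2 D)) \<le>
    9 * (A * sqrt (12 / t) ^ 3 + 8 / t * norm \<eta> + 256 / t\<^sup>2 * norm \<theta>)\<^sup>2"
  proof -
    \<comment> \<open>The half is cut again so that each of the two factors \<open>D\<close> has its
      own quarter for smoothing.\<close>
    have "?E (t / 2) = ?E (t / 4) * ?E (t / 4)"
      using exp_lw_split[of "t / 4" "t / 4"] by simp
    then have "exp Q * (D ^ 2 * exp_rem 2 D) = (?E (t / 4) * exp (lw ^ 2 * vQ)) *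
        (?E (t / 4) * exp_rem 2 D) * ((?E (t / 4) * D) * (?E (t / 4) * D))"
      unfolding expQ power2_eq_square[of D] by (simp only: mult_ac)
    moreover have "norm (?E (t / 4) * D) \<le> A * sqrt (12 / t) ^ 3 + 8 / t * norm \<eta> + 256 / t\<^sup>2 * norm \<theta>"
    proof -
      have "?E (t / 4) * D = A *\<^sub>R (?E (t / 4) * lw ^ 3) + ?E (t / 4) * lw ^ 2 * \<eta> + ?E (t / 4) * lw ^ 4 * \<theta>"
        unfolding D_eq by (simp add: algebra_simps)
      also have "norm \<dots> \<le> A * sqrt (12 / t) ^ 3 + 8 / t * norm \<eta> + 256 / t\<^sup>2 * norm \<theta>"
        using A q3 by (intro norm_mult_le order_trans[OF norm_triangle_ineq] add_mono q2 q4 order_refl)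
          (auto intro: mult_left_mono)
      finally show ?thesis .
    qed
    ultimately show ?thesis
      using norm_mult_le[OF norm_mult_le[OF nQ nR] norm_mult_le, of "?E (t / 4) * D" _ "?E (t / 4) * D"]
      by (simp add: power2_eq_square)
  qed
  moreover have "(A * sqrt (12 / t) ^ 3 + 8 / t * norm \<eta> + 256 / t\<^sup>2 * norm \<theta>)\<^sup>2 \<le>
      3 * (1728 * A\<^sup>2 / t ^ 3 + 64 * (norm \<eta> / t)\<^sup>2 + 65536 * (norm \<theta> / t\<^sup>2)\<^sup>2)"
  proof -
    have sq3: "(x + y + z)\<^sup>2 \<le> 3 * (x\<^sup>2 + y\<^sup>2 + z\<^sup>2)" for x y z :: real
      using sum_squares_ge_zero[of "x - y" "y - z"] zero_le_square[of "x - z"]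
      by (simp add: power2_eq_square algebra_simps)
    have "(sqrt (12 / t) ^ 3)\<^sup>2 = ((sqrt (12 / t))\<^sup>2) ^ 3"
      by (metis power_mult mult.commute)
    also have "(sqrt (12 / t))\<^sup>2 = 12 / t"
      using t by simp
    finally have "(sqrt (12 / t) ^ 3)\<^sup>2 = (12 / t) ^ 3" .
    then have "(A * sqrt (12 / t) ^ 3)\<^sup>2 = 1728 * A\<^sup>2 / t ^ 3"
      by (simp add: power_mult_distrib power_divide)
    moreover have "(8 / t * norm \<eta>)\<^sup>2 = 64 * (norm \<eta> / t)\<^sup>2" "(256 / t\<^sup>2 * norm \<theta>)\<^sup>2 = 65536 * (norm \<theta> / t\<^sup>2)\<^sup>2"
      by (simp_all add: power_mult_distrib power_divide)
    ultimately show ?thesis using sq3 by metis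
  qed
  ultimately show "norm (exp (Q + lw ^ 2 * vD) - exp Q * (1 + A *\<^sub>R lw ^ 3)) \<le>
      12 * norm \<eta> / t + 192 * norm \<theta> / t\<^sup>2 +
      27 * (1728 * A\<^sup>2 / t ^ 3 + 64 * (norm \<eta> / t)\<^sup>2 + 65536 * (norm \<theta> / t\<^sup>2)\<^sup>2)"
    using norm_triangle_ineq[of "exp Q * (lw ^ 2 * \<eta> + lw ^ 4 * \<theta>)" "exp Q * (D ^ 2 * exp_rem 2 D)"]
    by simp
qed

section \<open>Comparison with the binomial law\<close>

text \<open>From D \<le> 2 M K the unrounded parameter is at least K / (2M) \<ge> 50, so the floor
  loses at most two percent of K / (2M); hence K y \<le> M / 0.49 \<le> 2.05 M. The last two bounds
  measure the effect of the rounding on the second logarithmic coefficient.\<close>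

lemma floor_parameter_bounds:
  fixes K M :: real
  assumes M: "2 \<le> M" and K: "100 * M \<le> K"
  defines "D \<equiv> K * (2 * M - 1) - M * (M - 1)"
  defines "y \<equiv> 1 / real (nat \<lfloor>K\<^sup>2 / D\<rfloor>)"
  shows "0 < y" "K * y \<le> (205 / 100) * M" "0 \<le> y - D / K\<^sup>2" "K\<^sup>2 * (y - D / K\<^sup>2) \<le> (41 / 10) * M\<^sup>2"
proof -
  have K0: "K > 0" using M K by linarith
  have "M * M \<le> K * M" using M K by (intro mult_right_mono) auto
  moreover have "2 * K \<le> K * M" using M K0 by (simp add: mult.commute)
  moreover have "D = 2 * (K * M) - K - M * M + M" by (simp add: D_def algebra_simps)
  moreover have "M \<le> M * M" using M by simp
  ultimately have "0 < D" "D \<le> 2 * (K * M)" using K0 M by linarith+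
  then have D: "0 < D" "D \<le> 2 * M * K" by (simp_all add: mult_ac)
  define T where "T = K\<^sup>2 / D"
  have T: "K / (2 * M) \<le> T"
  proof -
    have "K / (2 * M) = K\<^sup>2 / (2 * M * K)" using K0 by (simp add: power2_eq_square)
    also have "\<dots> \<le> T" unfolding T_def using D K0 M by (intro divide_left_mono mult_pos_pos) auto
    finally show ?thesis .
  qed
  define X where "X = real (nat \<lfloor>T\<rfloor>)"
  have big: "50 \<le> K / (2 * M)" using M K by (simp add: field_simps)
  have X: "X \<le> T" "T - 1 \<le> X" using T big unfolding X_def by linarith+
  have XK: "(49 / 100) * K / M \<le> X"
  proof -
    have "(49 / 100) * K / M = (98 / 100) * (K / (2 * M))" by simp
    then show ?thesis using X T big by linarith
  qed
  have XK0: "0 < (49 / 100) * K / M" using K0 M by simp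
  have X0: "0 < X" using XK XK0 by linarith
  have y: "y = 1 / X" by (simp add: y_def X_def T_def)
  show "0 < y" using X0 y by simp
  have XM: "X * M \<ge> (49 / 100) * K" using XK M by (simp add: field_simps)
  show Ky: "K * y \<le> (205 / 100) * M"
  proof -
    have "0 < X * M" using X0 M by simp
    then have "K \<le> (41 / 20) * (X * M)" using XM by linarith
    then show ?thesis unfolding y using X0 by (simp add: field_simps)
  qed
  have T0: "T > 0" using T big by linarith
  have inv: "D / K\<^sup>2 = 1 / T" by (simp add: T_def)
  show "0 \<le> y - D / K\<^sup>2"
    unfolding inv y using X X0 T0 by (simp add: field_simps)
  \<comment> \<open>T - X \<le> 1 is the rounding error; the difference of reciprocals is this error
    over X T.\<close>
  have "y - D / K\<^sup>2 = (T - X) * (y * (D / K\<^sup>2))"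
    unfolding inv y using X0 T0 by (simp add: field_simps)
  also have "\<dots> \<le> 1 * (y * (D / K\<^sup>2))"
    using X \<open>0 < y\<close> D by (intro mult_right_mono) auto
  finally have "K\<^sup>2 * (y - D / K\<^sup>2) \<le> K\<^sup>2 * (y * (D / K\<^sup>2))" by (intro mult_left_mono) auto
  also have "\<dots> = y * D" using K0 by simp
  also have "\<dots> \<le> y * (2 * M * K)" using D \<open>0 < y\<close> by (intro mult_left_mono) auto
  also have "\<dots> = 2 * M * (K * y)" by simp
  also have "\<dots> \<le> 2 * M * ((205 / 100) * M)" using Ky M by (intro mult_left_mono) auto
  finally show "K\<^sup>2 * (y - D / K\<^sup>2) \<le> (41 / 10) * M\<^sup>2" by (simp add: power2_eq_square)
qed

text \<open>Up to the factor $a^3$: the third logarithmic coefficient of the number of runs, less $A$, less that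
  of the binomial law, where $y = 1/N$.\<close>

lemma third_cumulant_bound:
  fixes K M y :: real
  assumes M: "2 \<le> M" and K: "100 * M \<le> K"
  defines "D \<equiv> K * (2 * M - 1) - M * (M - 1)"
  assumes y: "0 < y" "K * y \<le> (205 / 100) * M" "0 \<le> y - D / K\<^sup>2" "K\<^sup>2 * (y - D / K\<^sup>2) \<le> (41 / 10) * M\<^sup>2"
  shows "\<bar>(K * (3 * M - 1) * (3 * M - 2) - 4 * M * (2 * M - 1) * (M - 1)) / 6
      - K * M * (M - 1) / 6 - K ^ 3 * y\<^sup>2 / 3\<bar> \<le> 7 * M ^ 3"
proof -
  have K0: "K > 0" using M K by linarith
  \<comment> \<open>At K y = 2M - 1 all terms of order K cancel, because (3M-1)(3M-2) - M(M-1) = 2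
    (2M-1)^2; this identity accounts for the value of A. The deviation d enters through a difference
    of squares and is only O(M^2).\<close>
  define d where "d = K * (K * y - (2 * M - 1))"
  have d: "d = K\<^sup>2 * (y - D / K\<^sup>2) - M * (M - 1)"
    unfolding d_def D_def using K0 by (simp add: field_simps power2_eq_square)
  have MM: "0 \<le> M * (M - 1)" "M * (M - 1) \<le> M\<^sup>2"
    using M by (auto simp: power2_eq_square intro!: mult_left_mono)
  have "0 \<le> K\<^sup>2 * (y - D / K\<^sup>2)" using y by (intro mult_nonneg_nonneg) auto
  then have ad: "\<bar>d\<bar> \<le> (41 / 10) * M\<^sup>2"
  proof -
    have "\<bar>z - w\<bar> \<le> (41 / 10) * u" if "0 \<le> z" "z \<le> (41 / 10) * u" "0 \<le> w" "w \<le> u" for z w u :: real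
      using that by linarith
    with \<open>0 \<le> K\<^sup>2 * (y - D / K\<^sup>2)\<close> y(4) MM show ?thesis unfolding d by blast
  qed
  have "(K * (3 * M - 1) * (3 * M - 2) - 4 * M * (2 * M - 1) * (M - 1)) / 6
      - K * M * (M - 1) / 6 - K ^ 3 * y\<^sup>2 / 3 =
      - (d * (2 * M - 1 + K * y) + 2 * M * (2 * M - 1) * (M - 1)) / 3"
    unfolding d_def by (simp add: field_simps power2_eq_square power3_eq_cube)
  moreover have "\<bar>d * (2 * M - 1 + K * y)\<bar> \<le> (41 / 10) * M\<^sup>2 * ((405 / 100) * M)"
  proof -
    have "0 \<le> K * y" using K0 y by simp
    then have "\<bar>2 * M - 1 + K * y\<bar> \<le> (405 / 100) * M" using y M by (simp add: abs_le_iff)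
    then show ?thesis unfolding abs_mult using ad by (intro mult_mono) auto
  qed
  moreover have "\<bar>2 * M * (2 * M - 1) * (M - 1)\<bar> \<le> 2 * M * (2 * M) * M"
    using M unfolding abs_mult by (intro mult_mono) auto
  moreover have "\<bar>- (u + v) / 3\<bar> \<le> (U + V) / 3" if "\<bar>u\<bar> \<le> U" "\<bar>v\<bar> \<le> V" for u v U V :: real
    using that unfolding abs_le_iff by (simp add: field_simps)
  ultimately have "\<bar>(K * (3 * M - 1) * (3 * M - 2) - 4 * M * (2 * M - 1) * (M - 1)) / 6
      - K * M * (M - 1) / 6 - K ^ 3 * y\<^sup>2 / 3\<bar> \<le> ((41 / 10) * M\<^sup>2 * ((405 / 100) * M) + 2 * M * (2 * M) * M) / 3"
    by presburger
  also have "\<dots> = (20605 / 1000) / 3 * M ^ 3"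
    by (simp add: power2_eq_square power3_eq_cube)
  also have "\<dots> \<le> 7 * M ^ 3"
    using M by (intro mult_right_mono) auto
  finally show ?thesis .
qed

text \<open>Everything is expressed by t = L a, the mean number of occurrences, and e = m a. The
  correction term is bounded separately, so that the estimate without it follows by the triangle
  inequality.\<close>

lemma run_gf_binomial_comparison:
  fixes a q A :: real
  assumes m: "2 \<le> m" and a: "0 < a" and ka: "1 \<le> real k * a" and ma: "real m * a \<le> 1 / 100"
  defines "N \<equiv> nat \<lfloor>(real k)\<^sup>2 / (real k * (2 * real m - 1) - real m * (real m - 1))\<rfloor>"
  defines "q \<equiv> real k * a / real N"
  defines "A \<equiv> a ^ 3 / 6 * real k * real m * (real m - 1)"
  shows "norm (run_gf m (a *\<^sub>R lw) (m - 1 + k) - (1 + q *\<^sub>R lw) ^ N * (1 + A *\<^sub>R lw ^ 3))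
      \<le> 10 ^ 8 * (a * (real m)\<^sup>2 * (a * real m + 1) / real k)" (is ?second)
    and "norm ((1 + q *\<^sub>R lw) ^ N * (A *\<^sub>R lw ^ 3)) \<le> 10 * (a powr (3 / 2) * (real m)\<^sup>2 / sqrt (real k))" (is ?third)
proof -
  define M K where "M = real m" and "K = real k"
  define y where "y = 1 / real N"
  define t where "t = K * a"
  define e where "e = a * M"
  have M: "2 \<le> M" using m by (simp add: M_def)
  have e: "0 < e" "e \<le> 1 / 100" using a M ma by (auto simp: e_def M_def mult.commute)
  have t1: "1 \<le> t" using ka by (simp add: t_def K_def)
  \<comment> \<open>L a \<ge> 1 \<ge> 100 m a: the two conditions on a force a row much longer than
    the pattern.\<close>
  have KM: "100 * M \<le> K"
  proof -
    have "100 * M * a \<le> K * a" using t1 ma by (simp add: t_def M_def)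
    then show ?thesis using a by simp
  qed
  have K0: "0 < K" using KM M by linarith
  define D where "D = K * (2 * M - 1) - M * (M - 1)"
  have N_eq: "N = nat \<lfloor>K\<^sup>2 / D\<rfloor>" by (simp add: N_def K_def D_def M_def)
  note y = floor_parameter_bounds[OF M KM, folded D_def, folded N_eq, folded y_def]
  have N0: "0 < real N" using y(1) by (simp add: y_def zero_less_divide_iff)
  have q: "q = t * y" by (simp add: q_def y_def t_def K_def)
  have Nq: "real N * q = t" using N0 by (simp add: q_def t_def K_def)
  have q_pos: "0 < q" using y(1) t1 by (simp add: q)
  have q_le: "q \<le> (205 / 100) * e"
    using mult_left_mono[OF y(2), of a] a by (simp add: q t_def e_def mult_ac)
  define c2 c3 where "c2 = - D / 2"
    and "c3 = (K * (3 * M - 1) * (3 * M - 2) - 4 * M * (2 * M - 1) * (M - 1)) / 6"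
  have nlw: "norm (a *\<^sub>R lw) \<le> 2 * a" using norm_lw a by simp
  have "8 * real m * norm (a *\<^sub>R lw) \<le> 8 * real m * (2 * a)"
    by (intro mult_left_mono nlw) simp
  also have "8 * real m * (2 * a) = 16 * (real m * a)" by simp
  finally have small: "8 * real m * norm (a *\<^sub>R lw) \<le> 1" using ma by linarith
  have "2 * m \<le> k" using KM M unfolding K_def M_def by linarith
  from run_gf_log[OF m this small] obtain s where
    s: "norm s \<le> 2048 * K * M ^ 3"
      "run_gf m (a *\<^sub>R lw) (m - 1 + k) = exp (K *\<^sub>R (a *\<^sub>R lw) + c2 *\<^sub>R (a *\<^sub>R lw) ^ 2 + c3 *\<^sub>R (a *\<^sub>R lw) ^ 3 + (a *\<^sub>R lw) ^ 4 * s)"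
    unfolding K_def M_def c2_def c3_def D_def by blast
  have "norm (q *\<^sub>R lw) \<le> 1 / 2"
    using norm_lw q_pos q_le e mult_mono[of q "(205 / 100) * e" "norm lw" 2] by simp
  then obtain l r where r: "exp l = 1 + q *\<^sub>R lw" "norm r \<le> 16"
    "l = q *\<^sub>R lw - (1 / 2) *\<^sub>R (q *\<^sub>R lw) ^ 2 + (1 / 3) *\<^sub>R (q *\<^sub>R lw) ^ 3 + (q *\<^sub>R lw) ^ 4 * r"
    by (rule ex_log)
  \<comment> \<open>This is N ln (1 + q w) to fourth order. As N q = t holds exactly in spite of the
    rounding, the linear part is t w, as for the runs, and the rest is divisible by w^2.\<close>
  define vQ where "vQ = (- (t * q / 2)) *\<^sub>R 1 + (t * q\<^sup>2 / 3) *\<^sub>R lw + (t * q ^ 3) *\<^sub>R (lw ^ 2 * r)"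
  define \<theta> where "\<theta> = a ^ 4 *\<^sub>R s - (t * q ^ 3) *\<^sub>R r"
  \<comment> \<open>The mismatch of the second and third coefficients, with A removed from the
    latter.\<close>
  define \<eta> where "\<eta> = (c2 * a\<^sup>2 + t * q / 2) *\<^sub>R 1 + (c3 * a ^ 3 - A - t * q\<^sup>2 / 3) *\<^sub>R lw"
  define vD where "vD = A *\<^sub>R lw + \<eta> + lw ^ 2 * \<theta>"
  define Q where "Q = t *\<^sub>R lw + lw ^ 2 * vQ"
  have expQ: "(1 + q *\<^sub>R lw) ^ N = exp Q"
  proof -
    have coeffs: "real N * q = t" "real N * q\<^sup>2 = t * q" "real N * q ^ 3 = t * q\<^sup>2" "real N * q ^ 4 = t * q ^ 3"
      by (simp_all add: Nq[symmetric] eval_nat_numeral)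
    have "real N *\<^sub>R l = (real N * q) *\<^sub>R lw - ((real N * q\<^sup>2) / 2) *\<^sub>R lw ^ 2 + ((real N * q ^ 3) / 3) *\<^sub>R lw ^ 3
        + (real N * q ^ 4) *\<^sub>R (lw ^ 4 * r)"
      by (simp add: r(3) algebra_simps)
    also have "\<dots> = Q"
      unfolding coeffs Q_def vQ_def by (simp add: algebra_simps eval_nat_numeral)
    finally show ?thesis by (simp add: r(1)[symmetric] exp_power_nat)
  qed
  have expP: "run_gf m (a *\<^sub>R lw) (m - 1 + k) = exp (Q + lw ^ 2 * vD)"
    unfolding s(2) Q_def vD_def \<eta>_def \<theta>_def vQ_def t_def
    by (intro arg_cong[where f = exp]) (simp add: algebra_simps eval_nat_numeral)
  have A: "0 \<le> A" "A \<le> t * e\<^sup>2 / 6"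
  proof -
    have "A = a ^ 3 / 6 * K * (M * (M - 1))" by (simp add: A_def K_def M_def)
    moreover have "0 \<le> M * (M - 1)" "M * (M - 1) \<le> M * M" using M by (auto intro!: mult_left_mono)
    moreover have "0 \<le> a ^ 3 / 6 * K" using a K0 by simp
    ultimately have "0 \<le> A" "A \<le> a ^ 3 / 6 * K * (M * M)"
      using mult_nonneg_nonneg mult_left_mono by metis+
    then show "0 \<le> A" "A \<le> t * e\<^sup>2 / 6" by (simp_all add: t_def e_def power2_eq_square power3_eq_cube mult_ac)
  qed
  have \<eta>: "norm \<eta> \<le> 3 * e\<^sup>2"
  proof -
    \<comment> \<open>As t q = a^2 K^2 y, this is pure rounding error: for unrounded N the second
      coefficients agree.\<close>
    have "c2 * a\<^sup>2 + t * q / 2 = a\<^sup>2 * (K\<^sup>2 * (y - D / K\<^sup>2)) / 2"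
      unfolding c2_def q t_def using K0 by (simp add: field_simps power2_eq_square)
    moreover have "0 \<le> a\<^sup>2 * (K\<^sup>2 * (y - D / K\<^sup>2))" using y(3) by (intro mult_nonneg_nonneg) auto
    moreover have "a\<^sup>2 * (K\<^sup>2 * (y - D / K\<^sup>2)) \<le> a\<^sup>2 * ((41 / 10) * M\<^sup>2)" by (intro mult_left_mono y) auto
    moreover have "a\<^sup>2 * ((41 / 10) * M\<^sup>2) = 2 * ((205 / 100) * e\<^sup>2)" by (simp add: e_def power_mult_distrib)
    moreover have "\<bar>w / 2\<bar> \<le> u" if "0 \<le> w" "w \<le> 2 * u" for w u :: real using that by simp
    ultimately have h2: "\<bar>c2 * a\<^sup>2 + t * q / 2\<bar> \<le> (205 / 100) * e\<^sup>2" by metis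
    have "c3 * a ^ 3 - A - t * q\<^sup>2 / 3 = a ^ 3 * (c3 - K * M * (M - 1) / 6 - K ^ 3 * y\<^sup>2 / 3)"
      unfolding q t_def A_def K_def M_def by (simp add: field_simps eval_nat_numeral)
    also have "\<bar>\<dots>\<bar> \<le> a ^ 3 * (7 * M ^ 3)"
      unfolding abs_mult using third_cumulant_bound[OF M KM y(1,2) y(3,4)[unfolded D_def]] a
      by (auto simp: c3_def intro!: mult_left_mono)
    finally have h3: "\<bar>c3 * a ^ 3 - A - t * q\<^sup>2 / 3\<bar> \<le> 7 * e ^ 3" by (simp add: e_def power_mult_distrib)
    have "norm \<eta> \<le> \<bar>c2 * a\<^sup>2 + t * q / 2\<bar> * 1 + \<bar>c3 * a ^ 3 - A - t * q\<^sup>2 / 3\<bar> * 2"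
      unfolding \<eta>_def using norm_lw by (intro order_trans[OF norm_triangle_ineq] add_mono) (auto intro: mult_left_mono)
    also have "\<dots> \<le> (205 / 100) * e\<^sup>2 + 14 * e * e\<^sup>2" using h2 h3 by (simp add: eval_nat_numeral)
    also have "\<dots> \<le> (205 / 100) * e\<^sup>2 + (14 / 100) * e\<^sup>2" using e by (intro add_mono mult_right_mono) auto
    finally show ?thesis using zero_le_power2[of e] by linarith
  qed
  have q3: "t * q ^ 3 \<le> 9 * t * e ^ 3"
  proof -
    have "q ^ 3 \<le> ((205 / 100) * e) ^ 3" using q_le q_pos by (intro power_mono) auto
    also have "\<dots> \<le> 9 * e ^ 3" using e by (simp add: power_mult_distrib power3_eq_cube)
    finally have "t * q ^ 3 \<le> t * (9 * e ^ 3)" using t1 by (intro mult_left_mono) auto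
    then show ?thesis by simp
  qed
  have \<theta>: "norm \<theta> \<le> 2200 * t * e ^ 3"
  proof -
    have "norm (a ^ 4 *\<^sub>R s) \<le> a ^ 4 * (2048 * K * M ^ 3)"
      using s(1) a by (simp add: mult_left_mono)
    moreover have "norm ((t * q ^ 3) *\<^sub>R r) \<le> (9 * t * e ^ 3) * 16"
      unfolding norm_scaleR using q3 r(2) t1 q_pos e by (intro mult_mono) (auto simp: abs_mult)
    ultimately have "norm \<theta> \<le> a ^ 4 * (2048 * K * M ^ 3) + (9 * t * e ^ 3) * 16"
      unfolding \<theta>_def by (intro order_trans[OF norm_triangle_ineq4] add_mono)
    also have "a ^ 4 * (2048 * K * M ^ 3) = 2048 * (t * e ^ 3)"
      by (simp add: t_def e_def eval_nat_numeral)
    finally have "norm \<theta> \<le> 2192 * (t * e ^ 3)" by simp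
    also have "\<dots> \<le> 2200 * (t * e ^ 3)" using t1 e by (intro mult_right_mono) auto
    finally show ?thesis by simp
  qed
  have e2: "e\<^sup>2 \<le> 1 / 10000" and e3: "e ^ 3 \<le> 1 / 1000000"
    using power_mono[of e "1/100" 2] power_mono[of e "1/100" 3] e by (simp_all add: power_divide)
  have nlw2: "norm (lw ^ 2 * x) \<le> 4 * norm x" for x
    using norm_mult_le[OF norm_mult_le[OF norm_lw norm_lw] order_refl, of x] by (simp add: power2_eq_square)
  have vQ: "132 * norm vQ \<le> 4 * t"
  proof -
    have "norm vQ \<le> t * q / 2 * 1 + t * q\<^sup>2 / 3 * 2 + (t * q ^ 3) * (4 * 16)"
    proof -
      have "norm ((- (t * q / 2)) *\<^sub>R (1::l1)) \<le> t * q / 2 * 1" using t1 q_pos by simp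
      moreover have "norm ((t * q\<^sup>2 / 3) *\<^sub>R lw) \<le> t * q\<^sup>2 / 3 * 2"
        unfolding norm_scaleR using t1 q_pos norm_lw by (intro mult_mono) auto
      moreover have "norm ((t * q ^ 3) *\<^sub>R (lw ^ 2 * r)) \<le> (t * q ^ 3) * (4 * 16)"
        unfolding norm_scaleR using t1 q_pos r(2) order_trans[OF nlw2[of r]] by (intro mult_mono) auto
      ultimately show ?thesis
        unfolding vQ_def by (intro order_trans[OF norm_triangle_ineq] add_mono)
    qed
    also have "\<dots> = t * (q / 2 + q\<^sup>2 * 2 / 3 + q ^ 3 * 64)" by (simp add: algebra_simps)
    also have "\<dots> \<le> t * (1 / 33)"
    proof (rule mult_left_mono)
      have q1: "q \<le> (205 / 10000)" using q_le e by simp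
      have "q\<^sup>2 \<le> (205 / 10000)\<^sup>2" "q ^ 3 \<le> (205 / 10000) ^ 3" using q1 q_pos by (auto intro!: power_mono)
      then show "q / 2 + q\<^sup>2 * 2 / 3 + q ^ 3 * 64 \<le> 1 / 33"
        using q1 by (simp add: power2_eq_square power3_eq_cube)
    qed (use t1 in simp)
    finally show ?thesis by simp
  qed
  have vD: "132 * norm vD \<le> 4 * t"
  proof -
    have "norm vD \<le> t * e\<^sup>2 / 6 * 2 + 3 * e\<^sup>2 + 4 * (2200 * t * e ^ 3)"
    proof -
      have "norm (A *\<^sub>R lw) \<le> t * e\<^sup>2 / 6 * 2"
        unfolding norm_scaleR using A norm_lw by (intro mult_mono) auto
      moreover have "norm (lw ^ 2 * \<theta>) \<le> 4 * (2200 * t * e ^ 3)"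
        using nlw2[of \<theta>] \<theta> by simp
      ultimately show ?thesis
        unfolding vD_def by (intro order_trans[OF norm_triangle_ineq] add_mono \<eta>)
    qed
    also have "\<dots> \<le> t * e\<^sup>2 / 6 * 2 + t * (3 * e\<^sup>2) + 4 * (2200 * t * e ^ 3)"
      using t1 mult_right_mono[OF t1, of "3 * e\<^sup>2"] by simp
    also have "\<dots> = t * (10 / 3 * e\<^sup>2 + 8800 * e ^ 3)" by (simp add: algebra_simps)
    \<comment> \<open>The dominant term at e = 1/100 is 8800 e^3, inherited from the constant 2048
      of the logarithmic remainder.\<close>
    also have "\<dots> \<le> t * (1 / 33)" using e2 e3 t1 by (intro mult_left_mono) auto
    finally show ?thesis by simp
  qed
  have t0: "0 < t" using t1 by simp
  note cmp = exp_comparison[OF t0 A(1) vQ vD vD_def, folded Q_def]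
  define B where "B = e\<^sup>2 * (e + 1) / t"
  have B_eq: "B = a * (real m)\<^sup>2 * (a * real m + 1) / real k"
    using a K0 unfolding B_def e_def t_def M_def K_def by (simp add: field_simps power2_eq_square)
  have b1: "e\<^sup>2 / t \<le> B" and b2: "e ^ 3 / t \<le> B"
    unfolding B_def using e t0 by (auto intro!: divide_right_mono simp: power2_eq_square power3_eq_cube algebra_simps)
  have "norm (exp (Q + lw ^ 2 * vD) - exp Q * (1 + A *\<^sub>R lw ^ 3)) \<le> 10 ^ 8 * B"
  proof -
    have "norm \<eta> / t \<le> 3 * (e\<^sup>2 / t)" using \<eta> t0 by (simp add: divide_right_mono)
    moreover have x1: "e\<^sup>2 / t \<le> 1" using e2 t1 by (simp add: field_simps)
    ultimately have eta1: "norm \<eta> / t \<le> 3 * B" and eta2: "norm \<eta> / t \<le> 3"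
      using b1 by auto
    \<comment> \<open>In each square one factor is bounded by an absolute constant and the other by
      a multiple of B.\<close>
    have eta3: "(norm \<eta> / t)\<^sup>2 \<le> 3 * (3 * B)"
      unfolding power2_eq_square using eta1 eta2 t0 by (intro mult_mono) auto
    have "norm \<theta> / t\<^sup>2 \<le> 2200 * (e ^ 3 / t)"
      using divide_right_mono[OF \<theta>, of "t\<^sup>2"] t0 by (simp add: power2_eq_square)
    moreover have "e ^ 3 / t \<le> 1 / 1000000" using e3 t1 e by (simp add: field_simps)
    ultimately have th1: "norm \<theta> / t\<^sup>2 \<le> 2200 * B" and th2: "norm \<theta> / t\<^sup>2 \<le> (22 / 10000)"
      using b2 by linarith+
    have th3: "(norm \<theta> / t\<^sup>2)\<^sup>2 \<le> (22 / 10000) * (2200 * B)"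
      unfolding power2_eq_square[of "norm \<theta> / t\<^sup>2"] using th1 th2 t0 by (intro mult_mono) auto
    have "A\<^sup>2 \<le> (t * e\<^sup>2 / 6)\<^sup>2" using A by (intro power_mono) auto
    also have "\<dots> = t\<^sup>2 * e ^ 3 * (e / 36)" by (simp add: eval_nat_numeral)
    also have "\<dots> \<le> t\<^sup>2 * e ^ 3 * 1" using e t0 by (intro mult_left_mono) auto
    finally have "A\<^sup>2 / t ^ 3 \<le> t\<^sup>2 * e ^ 3 / t ^ 3" using t0 by (intro divide_right_mono) auto
    also have "\<dots> = e ^ 3 / t" using t0 by (simp add: eval_nat_numeral)
    finally have a3: "A\<^sup>2 / t ^ 3 \<le> B" using b2 by linarith
    have "0 \<le> B" unfolding B_def using e t0 by simp
    moreover note cmp(2)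
    ultimately show ?thesis using eta1 eta3 th1 th3 a3 by (simp add: power_divide)
  qed
  then show ?second unfolding expQ expP B_eq .
  have "norm (exp Q * (A *\<^sub>R lw ^ 3)) \<le> 45 * (t * e\<^sup>2 / 6) * sqrt (1 / t) ^ 3"
    using A t0 by (intro order_trans[OF cmp(1)] mult_right_mono) auto
  also have "\<dots> = (75 / 10) * (e\<^sup>2 / sqrt t)"
    using t0 by (simp add: real_sqrt_divide power3_eq_cube field_simps)
  also have "\<dots> = (75 / 10) * (a powr (3 / 2) * (real m)\<^sup>2 / sqrt (real k))"
  proof -
    have "a powr (3 / 2) = a * sqrt a"
      using a powr_add[of a 1 "1/2"] by (simp add: powr_half_sqrt)
    moreover have "a * a = a * sqrt a * sqrt a" using a by simp
    ultimately show ?thesis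
      using a K0 by (simp add: e_def t_def K_def M_def power2_eq_square real_sqrt_mult field_simps)
  qed
  also have "\<dots> \<le> 10 * (a powr (3 / 2) * (real m)\<^sup>2 / sqrt (real k))"
    by (intro mult_right_mono) auto
  finally show ?third unfolding expQ .
qed

section \<open>Signed measures on the integers and the distribution of the number of runs\<close>

definition int_measure :: "l1 \<Rightarrow> int \<Rightarrow> real" where
  "int_measure f k = (if 0 \<le> k then coeff1 f (nat k) else 0)"

lemma tv_norm_int_measure: "tv_norm (int_measure f) = norm f"
proof -
  have "tv_norm (int_measure f) = infsum (\<lambda>k. \<bar>int_measure f k\<bar>) (range int)"
    unfolding tv_norm_def
  proof (rule infsum_cong_neutral)
    fix k :: int assume "k \<in> UNIV - range int"
    then have "\<not> 0 \<le> k" by (metis DiffE nat_0_le rangeI)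
    then show "\<bar>int_measure f k\<bar> = 0" by (simp add: int_measure_def)
  qed auto
  also have "\<dots> = infsum (\<lambda>n. \<bar>coeff1 f n\<bar>) UNIV"
    by (subst infsum_reindex) (auto simp: comp_def int_measure_def)
  also have "\<dots> = norm f"
    unfolding norm_l1_altdef
    by (intro infsumI sums_nonneg_imp_has_sum summable_sums summable_coeff1) simp
  finally show ?thesis .
qed

lemma lookup_single_mult:
  "Poly_Mapping.lookup (Poly_Mapping.single i c * M) k = c * Poly_Mapping.lookup M (k - i)"
  for M :: "int \<Rightarrow>\<^sub>0 real"
proof -
  have "(k = i + q) = (q = k - i)" for q by auto
  then show ?thesis by (simp add: lookup_mult lookup_single when_mult)
qed

text \<open>Compatibility is required of the multiplication operators, which makes closure under products
  immediate.\<close>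

definition acts_as :: "(int \<Rightarrow>\<^sub>0 real) \<Rightarrow> l1 \<Rightarrow> bool" where
  "acts_as M f \<longleftrightarrow> (\<forall>M' f'. Poly_Mapping.lookup M' = int_measure f' \<longrightarrow>
     Poly_Mapping.lookup (M * M') = int_measure (f * f'))"

lemma acts_as_single:
  "acts_as (Poly_Mapping.single 0 c) (c *\<^sub>R 1)" "acts_as (Poly_Mapping.single 1 1) lX"
  by (auto simp: acts_as_def fun_eq_iff lookup_single_mult int_measure_def coeff1_lX_mult nat_diff_distrib)

lemma int_measure_add: "int_measure (f + g) k = int_measure f k + int_measure g k"
  and int_measure_diff: "int_measure (f - g) k = int_measure f k - int_measure g k"
  by (simp_all add: int_measure_def)

lemma acts_as_add: "acts_as M f \<Longrightarrow> acts_as N g \<Longrightarrow> acts_as (M + N) (f + g)"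
  unfolding acts_as_def by (intro allI impI ext) (simp add: distrib_right lookup_add int_measure_add)

lemma acts_as_diff: "acts_as M f \<Longrightarrow> acts_as N g \<Longrightarrow> acts_as (M - N) (f - g)"
  unfolding acts_as_def by (intro allI impI ext) (simp add: left_diff_distrib lookup_minus int_measure_diff)

lemma acts_as_mult: "acts_as M f \<Longrightarrow> acts_as N g \<Longrightarrow> acts_as (M * N) (f * g)"
  by (simp add: acts_as_def mult.assoc)

lemma acts_as_1: "acts_as 1 1"
  by (simp add: acts_as_def)

lemma acts_as_power: "acts_as M f \<Longrightarrow> acts_as (M ^ n) (f ^ n)"
  by (induction n) (auto intro: acts_as_1 acts_as_mult)

lemma acts_as_scaleM:
  assumes "acts_as M f"
  shows "acts_as (scaleM c M) (c *\<^sub>R f)"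
proof -
  have "scaleM c M = Poly_Mapping.single 0 c * M"
    by (rule poly_mapping_eqI) (simp add: lookup_single_mult lookup_scaleM)
  then show ?thesis using acts_as_mult[OF acts_as_single(1) assms, of c] by simp
qed

text \<open>A measure is recovered from its multiplication operator by applying it to the
  unit.\<close>

lemma lookup_eq_int_measure:
  assumes "acts_as M f"
  shows "Poly_Mapping.lookup M = int_measure f"
proof -
  have "Poly_Mapping.lookup 1 = int_measure 1"
    by (auto simp: fun_eq_iff lookup_one int_measure_def when_def)
  then show ?thesis using assms unfolding acts_as_def by (metis mult_1_right)
qed

lemma acts_as_lw: "acts_as (unit_mass 1 - unit_mass 0) lw"
  unfolding lw_def using acts_as_diff[OF acts_as_single(2) acts_as_single(1)[of 1]] by simp

lemma acts_as_Bi: "acts_as (Bi N q) ((1 + q *\<^sub>R lw) ^ N)"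
  unfolding Bi_def using acts_as_single(1)[of 1]
  by (intro acts_as_power acts_as_add acts_as_scaleM acts_as_lw) simp

section \<open>Occurrences of the pattern and their probability generating function\<close>

lemma run_Y_eq_0_or_1:
  assumes "\<And>i. \<eta> i \<in> {0, 1}"
  shows "run_Y k1 k2 \<eta> j \<in> {0, 1}"
proof -
  have prod: "(\<Prod>i\<in>I. f i) \<in> {0, 1}" if "finite I" "\<And>i. f i \<in> {0, 1 :: int}" for I :: "nat set" and f
    using that(1)
  proof (induction I rule: finite_induct)
    case (insert i I)
    then show ?case using that(2)[of i] by auto
  qed simp
  have "(\<Prod>i\<in>{j - (k1 + k2) + 1..j - k2}. 1 - \<eta> i) \<in> {0, 1}"
  proof (rule prod)
    show "1 - \<eta> i \<in> {0, 1}" for i using assms[of i] by auto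
  qed simp
  moreover have "(\<Prod>i\<in>{j - k2 + 1..j}. \<eta> i) \<in> {0, 1}"
    by (rule prod) (simp_all only: finite_atLeastAtMost assms)
  ultimately show ?thesis unfolding run_Y_def by auto
qed

text \<open>Suppose occurrences ended at j and at n. If j \<le> n - k2, position j is the last
  success of the first and a failure of the second. Otherwise n - k2 is the last failure of the
  second and lies among the successes of the first.\<close>

lemma run_Y_isolated:
  assumes "run_Y k1 k2 \<eta> n \<noteq> 0" and \<eta>: "\<And>i. \<eta> i \<in> {0, 1}" and k: "1 \<le> k1" "1 \<le> k2"
    and j: "k1 + k2 \<le> j" "n < j + (k1 + k2)" "j < n"
  shows "run_Y k1 k2 \<eta> j = 0"
proof (rule ccontr)
  assume nz: "run_Y k1 k2 \<eta> j \<noteq> 0"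
  have one: "\<eta> i = 1" if "i \<in> {l - k2 + 1..l}" "run_Y k1 k2 \<eta> l \<noteq> 0" for i l
    using that \<eta>[of i] unfolding run_Y_def by auto
  have zero: "\<eta> i = 0" if "i \<in> {l - (k1 + k2) + 1..l - k2}" "run_Y k1 k2 \<eta> l \<noteq> 0" for i l
  proof -
    have "1 - \<eta> i \<noteq> 0" using that unfolding run_Y_def by (auto simp: prod_zero_iff)
    then show ?thesis using \<eta>[of i] by auto
  qed
  have "\<eta> j = 1" by (rule one[OF _ nz]) (use k j in auto)
  moreover have "j \<in> {n - (k1 + k2) + 1..n - k2}" if "j \<le> n - k2"
    unfolding atLeastAtMost_iff using that j k by arith
  ultimately have "\<not> j \<le> n - k2" using zero[of j n] assms(1) by auto
  then have "\<eta> (n - k2) = 1" by (intro one[OF _ nz]) (use k j in auto)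
  moreover have "\<eta> (n - k2) = 0" by (rule zero[OF _ assms(1)]) (use k j in auto)
  ultimately show False by simp
qed

lemma run_N_nonneg:
  assumes "\<And>i. \<eta> i \<in> {0, 1}"
  shows "0 \<le> run_N n k1 k2 \<eta>"
  unfolding run_N_def
proof (rule sum_nonneg)
  show "0 \<le> run_Y k1 k2 \<eta> j" for j
    using run_Y_eq_0_or_1[of \<eta> k1 k2 j, OF assms] by auto
qed

text \<open>A pointwise identity. If an occurrence ends at n, none ends at the m - 1 positions
  before, so the count up to n - 1 equals that up to n - m, which does not involve the variables
  entering the occurrence at n.\<close>

lemma run_N_power_rec:
  fixes z :: real
  assumes \<eta>: "\<And>i. \<eta> i \<in> {0, 1}" and k: "1 \<le> k1" "1 \<le> k2" and n: "k1 + k2 \<le> n"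
  shows "z ^ nat (run_N n k1 k2 \<eta>) = z ^ nat (run_N (n - 1) k1 k2 \<eta>) +
    (z - 1) * (real_of_int (run_Y k1 k2 \<eta> n) * z ^ nat (run_N (n - (k1 + k2)) k1 k2 \<eta>))"
proof -
  have "{k1 + k2..n} = insert n {k1 + k2..n - 1}" using n k by auto
  moreover have "n \<notin> {k1 + k2..n - 1}" using n k by auto
  ultimately have N: "run_N n k1 k2 \<eta> = run_Y k1 k2 \<eta> n + run_N (n - 1) k1 k2 \<eta>"
    unfolding run_N_def by simp
  show ?thesis
  proof (cases "run_Y k1 k2 \<eta> n = 0")
    case False
    then have Y: "run_Y k1 k2 \<eta> n = 1" using run_Y_eq_0_or_1[of \<eta> k1 k2 n, OF \<eta>] by auto
    have "run_N (n - 1) k1 k2 \<eta> = run_N (n - (k1 + k2)) k1 k2 \<eta>"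
      unfolding run_N_def
    proof (rule sum.mono_neutral_right)
      show "\<forall>j\<in>{k1 + k2..n - 1} - {k1 + k2..n - (k1 + k2)}. run_Y k1 k2 \<eta> j = 0"
      proof
        fix j assume "j \<in> {k1 + k2..n - 1} - {k1 + k2..n - (k1 + k2)}"
        then show "run_Y k1 k2 \<eta> j = 0"
          using n k by (intro run_Y_isolated[OF False \<eta> k]) auto
      qed
    qed (use k in auto)
    then show ?thesis
      using run_N_nonneg[of \<eta> "n - 1" k1 k2, OF \<eta>] by (simp add: N Y nat_add_distrib algebra_simps)
  qed (simp add: N)
qed

definition bernoulli_seq :: "nat \<Rightarrow> real \<Rightarrow> (nat \<Rightarrow> int) pmf" where
  "bernoulli_seq n p = Pi_pmf {1..n} 0 (\<lambda>_. bernoulli_law p)"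

context
  fixes p :: real
  assumes p: "0 < p" "p < 1"
begin

lemma bernoulli_seq_01: "\<eta> \<in> set_pmf (bernoulli_seq n p) \<Longrightarrow> \<eta> i \<in> {0, 1}"
  using pmf_bernoulli_law(3)[of p] p
  unfolding bernoulli_seq_def by (cases "i \<in> {1..n}") (auto simp: set_Pi_pmf PiE_dflt_def)

lemma finite_set_bernoulli_seq: "finite (set_pmf (bernoulli_seq n p))"
proof (rule finite_subset)
  show "set_pmf (bernoulli_seq n p) \<subseteq> PiE_dflt {1..n} 0 (\<lambda>_. {0, 1})"
    using pmf_bernoulli_law(3)[of p] p
    unfolding bernoulli_seq_def by (auto simp: set_Pi_pmf PiE_dflt_def)
qed (intro finite_PiE_dflt, auto)

lemma bernoulli_seq_restrict:
  assumes "j \<le> n"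
  shows "measure_pmf.expectation (bernoulli_seq n p) (\<lambda>\<eta>. f (run_N j k1 k2 \<eta>)) =
    measure_pmf.expectation (bernoulli_seq j p) (\<lambda>\<eta>. f (run_N j k1 k2 \<eta>) :: real)"
proof -
  have "bernoulli_seq j p = map_pmf (\<lambda>f x. if x \<in> {1..j} then f x else 0) (bernoulli_seq n p)"
    unfolding bernoulli_seq_def by (rule Pi_pmf_subset) (use assms in auto)
  moreover have "run_N j k1 k2 (\<lambda>x. if x \<in> {1..j} then \<eta> x else 0) = run_N j k1 k2 \<eta>" for \<eta>
    by (rule run_N_cong) auto
  ultimately show ?thesis by simp
qed

lemma expectation_bernoulli_law:
  "measure_pmf.expectation (bernoulli_law p) f = (1 - p) * f 0 + p * (f 1 :: real)"
  using pmf_bernoulli_law[of p] p by (subst integral_measure_pmf_real[of "{0, 1}"]) auto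

text \<open>The occurrence at n reads the last k1 + k2 coordinates and the count reads the others,
  so the joint law is split into an independent pair. Finite supports reduce factorisation to finite
  sums.\<close>

lemma expectation_run_Y_mult:
  assumes k: "1 \<le> k1" "1 \<le> k2" and n: "k1 + k2 \<le> n"
  shows "measure_pmf.expectation (bernoulli_seq n p)
      (\<lambda>\<eta>. real_of_int (run_Y k1 k2 \<eta> n) * f (run_N (n - (k1 + k2)) k1 k2 \<eta>)) =
    (1 - p) ^ k1 * p ^ k2 *
      measure_pmf.expectation (bernoulli_seq (n - (k1 + k2)) p) (\<lambda>\<eta>. f (run_N (n - (k1 + k2)) k1 k2 \<eta>) :: real)"
proof -
  define l where "l = n - (k1 + k2)"
  define Q where "Q = Pi_pmf {l + 1..n} 0 (\<lambda>_. bernoulli_law p)"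
  have Q01: "\<eta> i \<in> {0, 1}" if "\<eta> \<in> set_pmf Q" for \<eta> i
    using pmf_bernoulli_law(3)[of p] p that
    unfolding Q_def by (cases "i \<in> {l + 1..n}") (auto simp: set_Pi_pmf PiE_dflt_def)
  have "finite (set_pmf Q)"
  proof (rule finite_subset)
    show "set_pmf Q \<subseteq> PiE_dflt {l + 1..n} 0 (\<lambda>_. {0, 1})"
      using pmf_bernoulli_law(3)[of p] p
      unfolding Q_def by (auto simp: set_Pi_pmf PiE_dflt_def)
  qed (intro finite_PiE_dflt, auto)
  let ?B = "bernoulli_seq l p"
  let ?h = "\<lambda>(g, h) x. if x \<in> {1..l} then g x else h x :: int"
  have "{1..n} = {1..l} \<union> {l + 1..n}" using n by (auto simp: l_def)
  then have seq: "bernoulli_seq n p = map_pmf ?h (pair_pmf ?B Q)"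
    unfolding bernoulli_seq_def Q_def by (simp only:) (rule Pi_pmf_union, auto)
  have Y: "run_Y k1 k2 (?h (g, h)) n = run_Y k1 k2 h n" for g h
    unfolding run_Y_def by (intro arg_cong2[where f = "(*)"] prod.cong refl) (use n in \<open>auto simp: l_def\<close>)
  have Nl: "run_N l k1 k2 (?h (g, h)) = run_N l k1 k2 g" for g h
    by (rule run_N_cong) auto
  have indep: "measure_pmf.expectation (pair_pmf ?B Q) (\<lambda>x. u (fst x) * v (snd x)) =
      measure_pmf.expectation ?B u * measure_pmf.expectation Q v" for u v :: "_ \<Rightarrow> real"
  proof -
    have "measure_pmf.expectation (pair_pmf ?B Q) (\<lambda>x. u (fst x) * v (snd x)) =
      (\<Sum>x\<in>set_pmf ?B \<times> set_pmf Q. u (fst x) * v (snd x) * pmf (pair_pmf ?B Q) x)"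
      by (rule integral_measure_pmf_real) (use finite_set_bernoulli_seq \<open>finite (set_pmf Q)\<close> in auto)
    also have "\<dots> = (\<Sum>g\<in>set_pmf ?B. \<Sum>h\<in>set_pmf Q. (u g * pmf ?B g) * (v h * pmf Q h))"
      unfolding sum.cartesian_product by (auto simp: pmf_pair mult_ac intro!: sum.cong)
    also have "\<dots> = (\<Sum>g\<in>set_pmf ?B. u g * pmf ?B g) * (\<Sum>h\<in>set_pmf Q. v h * pmf Q h)"
      by (simp add: sum_product)
    also have "\<dots> = measure_pmf.expectation ?B u * measure_pmf.expectation Q v"
      using finite_set_bernoulli_seq \<open>finite (set_pmf Q)\<close>
      by (subst (1 2) integral_measure_pmf_real[OF _ ]) auto
    finally show ?thesis .
  qed
  have EY: "measure_pmf.expectation Q (\<lambda>h. real_of_int (run_Y k1 k2 h n)) = (1 - p) ^ k1 * p ^ k2"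
  proof -
    \<comment> \<open>One weight per position merges the failure and success blocks into a single
      product, to which the product formula for \<open>Pi_pmf\<close> applies.\<close>
    define w where "w i x = (if i \<le> n - k2 then 1 - real_of_int x else real_of_int x)" for i and x :: int
    have split: "{l + 1..n} = {l + 1..n - k2} \<union> {n - k2 + 1..n}" using n by (auto simp: l_def)
    have wY: "real_of_int (run_Y k1 k2 h n) = (\<Prod>i\<in>{l + 1..n}. w i (h i))" for h
    proof -
      have "(\<Prod>i\<in>{l + 1..n}. w i (h i)) = (\<Prod>i\<in>{l + 1..n - k2}. w i (h i)) * (\<Prod>i\<in>{n - k2 + 1..n}. w i (h i))"
        unfolding split by (rule prod.union_disjoint) auto
      then show ?thesis
        unfolding run_Y_def of_int_mult of_int_prod l_def
        by (auto simp: w_def intro!: arg_cong2[where f = "(*)"] prod.cong)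
    qed
    have "measure_pmf.expectation Q (\<lambda>h. \<Prod>i\<in>{l + 1..n}. w i (h i)) =
        (\<Prod>i\<in>{l + 1..n}. measure_pmf.expectation (bernoulli_law p) (w i))"
      unfolding Q_def
    proof (rule expectation_prod_Pi_pmf)
      show "integrable (measure_pmf (bernoulli_law p)) (w i)" for i
        using pmf_bernoulli_law(3)[of p] p by (intro integrable_measure_pmf_finite) (auto intro: finite_subset)
      show "0 \<le> w i x" if "x \<in> set_pmf (bernoulli_law p)" for i x
        using pmf_bernoulli_law(3)[of p] p that by (auto simp: w_def)
    qed auto
    also have "\<dots> = (\<Prod>i\<in>{l + 1..n}. if i \<le> n - k2 then 1 - p else p)"
      by (intro prod.cong) (auto simp: expectation_bernoulli_law w_def)
    also have "\<dots> = (\<Prod>i\<in>{l + 1..n - k2}. 1 - p) * (\<Prod>i\<in>{n - k2 + 1..n}. p)"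
      unfolding split by (subst prod.union_disjoint) (auto intro!: arg_cong2[where f = "(*)"] prod.cong)
    also have "\<dots> = (1 - p) ^ k1 * p ^ k2" using n by (simp add: l_def)
    finally show ?thesis unfolding wY .
  qed
  have "measure_pmf.expectation (bernoulli_seq n p) (\<lambda>\<eta>. real_of_int (run_Y k1 k2 \<eta> n) * f (run_N l k1 k2 \<eta>)) =
      measure_pmf.expectation (pair_pmf ?B Q) (\<lambda>x. f (run_N l k1 k2 (fst x)) * real_of_int (run_Y k1 k2 (snd x) n))"
    unfolding seq integral_map_pmf
    by (intro arg_cong[where f = "integral\<^sup>L _"] ext) (use Y Nl in \<open>auto simp: case_prod_unfold mult.commute\<close>)
  also have "\<dots> = measure_pmf.expectation ?B (\<lambda>g. f (run_N l k1 k2 g)) * ((1 - p) ^ k1 * p ^ k2)"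
    using indep[of "\<lambda>g. f (run_N l k1 k2 g)" "\<lambda>h. real_of_int (run_Y k1 k2 h n)"] EY by simp
  finally show ?thesis by (simp add: l_def mult.commute)
qed

lemma expectation_run_N_power:
  fixes z :: real
  assumes k: "1 \<le> k1" "1 \<le> k2"
  shows "measure_pmf.expectation (bernoulli_seq n p) (\<lambda>\<eta>. z ^ nat (run_N n k1 k2 \<eta>)) =
    run_gf (k1 + k2) ((1 - p) ^ k1 * p ^ k2 * (z - 1)) n"
proof (induction n rule: less_induct)
  case (less n)
  let ?E = "\<lambda>j f. measure_pmf.expectation (bernoulli_seq j p) (f :: _ \<Rightarrow> real)"
  show ?case
  proof (cases "n < k1 + k2")
    case True
    then have "run_N n k1 k2 \<eta> = 0" for \<eta> by (simp add: run_N_def)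
    then show ?thesis using True by (simp add: run_gf_init)
  next
    case False
    then have n: "k1 + k2 \<le> n" by simp
    note int = integrable_measure_pmf_finite[OF finite_set_bernoulli_seq]
    have "?E n (\<lambda>\<eta>. z ^ nat (run_N n k1 k2 \<eta>)) =
      ?E n (\<lambda>\<eta>. z ^ nat (run_N (n - 1) k1 k2 \<eta>) +
        (z - 1) * (real_of_int (run_Y k1 k2 \<eta> n) * z ^ nat (run_N (n - (k1 + k2)) k1 k2 \<eta>)))"
      by (intro integral_cong_AE AE_pmfI run_N_power_rec[OF bernoulli_seq_01 k n]) auto
    also have "\<dots> = ?E (n - 1) (\<lambda>\<eta>. z ^ nat (run_N (n - 1) k1 k2 \<eta>)) +
      (z - 1) * ((1 - p) ^ k1 * p ^ k2 * ?E (n - (k1 + k2)) (\<lambda>\<eta>. z ^ nat (run_N (n - (k1 + k2)) k1 k2 \<eta>)))"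
      using expectation_run_Y_mult[OF k n, of "\<lambda>x. z ^ nat x"]
        bernoulli_seq_restrict[of "n - 1" n "\<lambda>x. z ^ nat x" k1 k2]
      by (simp add: int)
    also have "\<dots> = run_gf (k1 + k2) ((1 - p) ^ k1 * p ^ k2 * (z - 1)) n"
      using less.IH[of "n - 1"] less.IH[of "n - (k1 + k2)"] n k run_gf_rec[of "k1 + k2" n "(1 - p) ^ k1 * p ^ k2 * (z - 1)"]
      by simp
    finally show ?thesis .
  qed
qed

text \<open>Evaluation at z sends \<open>lw\<close> to z - 1, so the scalar formula for the
  probability generating function on the open unit interval lifts to an identity of measures by
  \<open>l1_eqI_leval\<close>.\<close>

lemma pmf_run_H:
  assumes k: "1 \<le> k1" "1 \<le> k2"
  shows "pmf (run_H n k1 k2 p) = int_measure (run_gf (k1 + k2) (((1 - p) ^ k1 * p ^ k2) *\<^sub>R lw) n)"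
proof -
  let ?H = "run_H n k1 k2 p" and ?a = "(1 - p) ^ k1 * p ^ k2"
  have H: "?H = map_pmf (run_N n k1 k2) (bernoulli_seq n p)"
    by (simp add: run_H_def bernoulli_seq_def)
  have fin: "finite (set_pmf ?H)" by (simp add: H finite_set_bernoulli_seq)
  have nonneg: "0 \<le> i" if "i \<in> set_pmf ?H" for i
    using that by (auto simp: H intro!: run_N_nonneg bernoulli_seq_01)
  have fin': "finite (nat ` set_pmf ?H)" using fin by simp
  have out: "pmf ?H (int i) = 0" if "i \<notin> nat ` set_pmf ?H" for i
    using that by (metis image_eqI nat_int set_pmf_iff)
  define h where "h = Abs_l1 (Abs_fps (\<lambda>i. pmf ?H (int i)))"
  have h: "coeff1 h i = pmf ?H (int i)" for i
    unfolding h_def by (rule coeff1_Abs, rule summable_finite[OF fin']) (use out in auto)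
  have "h = run_gf (k1 + k2) (?a *\<^sub>R lw) n"
  proof (rule l1_eqI_leval)
    fix z :: real assume "\<bar>z\<bar> < 1"
    then have z: "norm z \<le> 1" by simp
    have "leval z h = (\<Sum>i\<in>nat ` set_pmf ?H. pmf ?H (int i) * z ^ i)"
      unfolding leval_def h by (subst suminf_finite[OF fin']) (use out in auto)
    also have "\<dots> = (\<Sum>i\<in>set_pmf ?H. z ^ nat i * pmf ?H i)"
    proof -
      have "inj_on nat (set_pmf ?H)" using nonneg by (meson eq_nat_nat_iff inj_onI)
      then show ?thesis using nonneg by (simp add: sum.reindex mult.commute)
    qed
    also have "\<dots> = measure_pmf.expectation ?H (\<lambda>i. z ^ nat i)"
      by (rule integral_measure_pmf_real[symmetric]) (use fin in auto)
    also have "\<dots> = run_gf (k1 + k2) (?a * (z - 1)) n"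
      unfolding H integral_map_pmf by (rule expectation_run_N_power[OF k])
    also have "\<dots> = leval z (run_gf (k1 + k2) (?a *\<^sub>R lw) n)"
      using bounded_linear.linear[OF bounded_linear_leval[OF z]]
      by (simp add: leval_run_gf[OF z] leval_scaleR[OF z] lw_def linear_diff leval_lX[OF z] leval_1[OF z])
    finally show "leval z h = leval z (run_gf (k1 + k2) (?a *\<^sub>R lw) n)" .
  qed
  moreover have "pmf ?H = int_measure h"
    using nonneg by (auto simp: fun_eq_iff int_measure_def h set_pmf_iff)
  ultimately show ?thesis by simp
qed

end

text \<open>Only the second estimate needs the comparison of exponentials. The first adds the norm
  of the correction term and uses that the second right-hand side is at most twice the first
  one.\<close>

lemma run_H_comparison:
  fixes k1 k2 n :: nat and p :: real
  defines "m \<equiv> k1 + k2" and "a \<equiv> (1 - p) ^ k1 * p ^ k2"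
  defines "L \<equiv> real n - real m + 1"
  defines "N \<equiv> nat \<lfloor>L\<^sup>2 / (L * (2 * real m - 1) - real m * (real m - 1))\<rfloor>"
  defines "q \<equiv> L * a / real N" and "A \<equiv> a ^ 3 / 6 * L * real m * (real m - 1)"
  defines "H \<equiv> pmf (run_H n k1 k2 p)"
  assumes k: "1 \<le> k1" "1 \<le> k2" and p: "0 < p" "p < 1" and n: "m \<le> n"
    and La: "1 \<le> L * a" and ma: "real m * a \<le> 1 / 100"
  shows "tv_norm (\<lambda>k. H k - Poly_Mapping.lookup (Bi N q) k)
        \<le> 10 ^ 9 * (a powr (3 / 2) * (real m)\<^sup>2 / sqrt L)" (is ?first)
    and "tv_norm (\<lambda>k. H k -
          Poly_Mapping.lookup (Bi N q * (unit_mass 0 + scaleM A ((unit_mass 1 - unit_mass 0) ^ 3))) k)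
        \<le> 10 ^ 9 * (a * (real m)\<^sup>2 * (a * real m + 1) / L)" (is ?second)
proof -
  define k where "k = n - m + 1"
  have L: "L = real k" using n by (simp add: L_def k_def of_nat_diff)
  have nk: "n = m - 1 + k" using n \<open>1 \<le> k1\<close> by (simp add: k_def m_def)
  have a0: "0 < a" using p by (simp add: a_def)
  have m2: "2 \<le> m" using \<open>1 \<le> k1\<close> \<open>1 \<le> k2\<close> by (simp add: m_def)
  define F B where "F = run_gf m (a *\<^sub>R lw) n" and "B = (1 + q *\<^sub>R lw) ^ N"
  have H: "H = int_measure F"
    unfolding H_def F_def m_def a_def by (rule pmf_run_H[OF p \<open>1 \<le> k1\<close> \<open>1 \<le> k2\<close>])
  have tv: "tv_norm (\<lambda>k. H k - Poly_Mapping.lookup M k) = norm (F - f)" if "acts_as M f" for M f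
  proof -
    have "(\<lambda>k. H k - Poly_Mapping.lookup M k) = int_measure (F - f)"
      unfolding H lookup_eq_int_measure[OF that] by (auto simp: int_measure_diff)
    then show ?thesis by (simp add: tv_norm_int_measure)
  qed
  note cmp = run_gf_binomial_comparison[OF m2 a0 La[unfolded L] ma, folded L, folded N_def,
      folded q_def A_def B_def, folded nk, folded F_def]
  have second: "norm (F - B * (1 + A *\<^sub>R lw ^ 3)) \<le> 10 ^ 8 * (a * (real m)\<^sup>2 * (a * real m + 1) / L)"
    and third: "norm (B * (A *\<^sub>R lw ^ 3)) \<le> 10 * (a powr (3 / 2) * (real m)\<^sup>2 / sqrt L)"
    unfolding B_def by (rule cmp)+
  have L0: "0 < L" using La a0 by (metis L not_one_le_zero mult_zero_left of_nat_0_less_iff of_nat_eq_0_iff neq0_conv)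
  have "acts_as (Bi N q * (unit_mass 0 + scaleM A ((unit_mass 1 - unit_mass 0) ^ 3))) (B * (1 + A *\<^sub>R lw ^ 3))"
    unfolding B_def using acts_as_single(1)[of 1]
    by (intro acts_as_mult acts_as_add acts_as_Bi acts_as_scaleM acts_as_power acts_as_lw) simp
  from tv[OF this] second have s: "tv_norm (\<lambda>k. H k -
          Poly_Mapping.lookup (Bi N q * (unit_mass 0 + scaleM A ((unit_mass 1 - unit_mass 0) ^ 3))) k)
        \<le> 10 ^ 8 * (a * (real m)\<^sup>2 * (a * real m + 1) / L)" by simp
  have "0 \<le> a * (real m)\<^sup>2 * (a * real m + 1) / L" using a0 L0 by simp
  then show ?second by (intro order_trans[OF s] mult_right_mono) simp_all
  \<comment> \<open>a m + 1 \<le> 2, and sqrt (L a) \<ge> 1 trades the factor 1 / L for sqrt a /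
    sqrt L.\<close>
  have "a * (real m)\<^sup>2 * (a * real m + 1) / L \<le> a * (real m)\<^sup>2 * 2 / L"
    using a0 L0 ma by (intro divide_right_mono mult_left_mono) (auto simp: mult.commute)
  also have "\<dots> \<le> 2 * (a powr (3 / 2) * (real m)\<^sup>2 / sqrt L)"
  proof -
    have "1 \<le> sqrt a * sqrt L" using La by (simp add: mult.commute flip: real_sqrt_mult)
    then have "a * (real m)\<^sup>2 * 2 * 1 \<le> a * (real m)\<^sup>2 * 2 * (sqrt a * sqrt L)"
      using a0 by (intro mult_left_mono) auto
    then have "a * (real m)\<^sup>2 * 2 / L \<le> a * (real m)\<^sup>2 * 2 * (sqrt a * sqrt L) / L"
      using L0 by (intro divide_right_mono) auto
    also have "\<dots> = 2 * (a * sqrt a * (real m)\<^sup>2 / sqrt L)"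
      using L0 by (simp add: field_simps)
    also have "a * sqrt a = a powr (3 / 2)"
      using a0 powr_add[of a 1 "1/2"] by (simp add: powr_half_sqrt)
    finally show ?thesis .
  qed
  finally have B: "a * (real m)\<^sup>2 * (a * real m + 1) / L \<le> 2 * (a powr (3 / 2) * (real m)\<^sup>2 / sqrt L)" .
  have "F - B = (F - B * (1 + A *\<^sub>R lw ^ 3)) + B * (A *\<^sub>R lw ^ 3)" by (simp add: distrib_left)
  then have "norm (F - B) \<le> norm (F - B * (1 + A *\<^sub>R lw ^ 3)) + norm (B * (A *\<^sub>R lw ^ 3))"
    by (metis norm_triangle_ineq)
  moreover have "v \<le> 10 ^ 9 * W" if "v \<le> x + y" "x \<le> 10 ^ 8 * X" "y \<le> 10 * W" "X \<le> 2 * W" "0 \<le> W"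
    for v x y X W :: real
    using that by simp
  moreover have "0 \<le> a powr (3 / 2) * (real m)\<^sup>2 / sqrt L" using L0 by simp
  ultimately have "norm (F - B) \<le> 10 ^ 9 * (a powr (3 / 2) * (real m)\<^sup>2 / sqrt L)"
    using second third B by blast
  moreover have "tv_norm (\<lambda>k. H k - Poly_Mapping.lookup (Bi N q) k) = norm (F - B)"
    by (rule tv) (simp add: B_def acts_as_Bi)
  ultimately show ?first by simp
qed

theorem theorem4p2:
  shows "\<exists>C>(0::real). \<forall>(k1::nat) (k2::nat) (n::nat) (p::real).
    let m = k1 + k2;
        a = (1 - p) ^ k1 * p ^ k2;
        L = real n - real m + 1;
        Nt = L\<^sup>2 / (L * (2 * real m - 1) - real m * (real m - 1));
        N = nat \<lfloor>Nt\<rfloor>;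
        q = L * a / real N;
        A = a ^ 3 / 6 * L * real m * (real m - 1);
        H = pmf (run_H n k1 k2 p)
    in k1 \<ge> 1 \<and> k2 \<ge> 1 \<and> 0 < p \<and> p < 1 \<and> n \<ge> m \<and> L * a \<ge> 1 \<and> real m * a \<le> 1 / 100
       \<longrightarrow> tv_norm (\<lambda>k. H k - Poly_Mapping.lookup (Bi N q) k)
             \<le> C * (a powr (3 / 2) * (real m)\<^sup>2 / sqrt L)
         \<and> tv_norm (\<lambda>k. H k -
               Poly_Mapping.lookup (Bi N q * (unit_mass 0 + scaleM A ((unit_mass 1 - unit_mass 0) ^ 3))) k)
             \<le> C * (a * (real m)\<^sup>2 * (a * real m + 1) / L)"
  unfolding Let_def
  by (rule exI[of _ "10 ^ 9"]) (intro conjI allI impI; (elim conjE)?; (rule run_H_comparison)?; simp)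

end
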